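(* Let $q=4$, $B=A$, $|A|=m-1$, and put $\theta=2^{4m+2|C|-3}$. (a) The coset graph $\Gamma_{\mathcal C_{\overline{\mathcal N}_2}^\perp}$ is a $3\theta$-regular graph with eigenvalues $3\theta,\ \theta,\ 0,\ -\theta$ having multiplicities $1,\ 6,\ 4^{2m+|C|}-16,\ 9$, respectively. (b) For every odd integer $\ell\ge3$, $\Gamma_{\mathcal C_{\overline{\mathcal N}_2}^\perp}$ is a strongly $\ell$-walk-regular graph with parameters $(\lambda_\ell,\mu_\ell,\nu_\ell)$, where $\lambda_\ell=\frac{(3^\ell-3)\theta^\ell}{4^{2m+|C|}}+\theta^{\ell-1}$ and $\mu_\ell=\nu_\ell=\frac{(3^\ell-3)\theta^\ell}{4^{2m+|C|}}$.
   Context: $\mathbb F_4$ is the field with four elements ($q=4$), $\mathbb F_4^*=\mathbb F_4\setminus\{0\}$, $m\ge2$, $[m]=\{1,\dots,m\}$, $\mathrm{supp}(v)=\{i:v_i\ne0\}$. For nonempty $P\subseteq[m]$, $\Delta_P=\{v\in\mathbb F_4^m:\mathrm{supp}(v)\subseteq P\}$, $\Delta_P^c=\mathbb F_4^m\setminus\Delta_P$. $A,B,C$ are nonempty subsets of $[m]$. Let $\mathcal N_2=\{(w_2+\omega,w_3,w_1)\in\mathbb F_4^{3m}: w_1\in\Delta_A^c,\ w_2\in\Delta_B,\ w_3\in\Delta_C,\ \omega\in\{\mathbf 0,w_1\}\}$, let $\overline{\mathcal N}_2$ contain exactly one element of each class $\{\alpha x:\alpha\in\mathbb F_4^*\}$,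 $x\in\mathcal N_2$, let $\mathcal C_{\overline{\mathcal N}_2}$ be the row span of the matrix whose columns are the elements of $\overline{\mathcal N}_2$, and $\mathcal C^\perp_{\overline{\mathcal N}_2}$ its Euclidean dual, of length $N$. For a linear code $\mathcal D\subseteq\mathbb F_q^N$, the weight of a coset is the minimum Hamming weight of its elements; the coset graph $\Gamma_{\mathcal D}$ has the cosets of $\mathcal D$ in $\mathbb F_q^N$ as vertices, two distinct cosets $x+\mathcal D$, $y+\mathcal D$ being adjacent iff the coset $x-y+\mathcal D$ has weight $1$. Eigenvalues of a graph are those of its adjacency matrix. For $\ell\ge2$, a graph is strongly $\ell$-walk-regular with parameters $(\lambda_\ell,\mu_\ell,\nu_\ell)$ if the number of walks of length $\ell$ between two vertices is $\lambda_\ell$ when they are adjacent, $\mu_\ell$ when they are distinct and non-adjacent, and $\nu_\ell$ when they are equal. *)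

theory Defs
  imports "HOL-Library.Function_Algebras" "HOL-Combinatorics.Permutations" "HOL-Computational_Algebra.Polynomial"
begin

text \<open>A vector of F^m is represented as a function nat => F vanishing outside {1..m}.\<close>

definition fvec :: "nat \<Rightarrow> (nat \<Rightarrow> 'f::zero) set" where
  "fvec m = {v. \<forall>i. v i \<noteq> 0 \<longrightarrow> i \<in> {1..m}}"

definition supp :: "(nat \<Rightarrow> 'f::zero) \<Rightarrow> nat set" where
  "supp v = {i. v i \<noteq> 0}"

definition Delta :: "nat \<Rightarrow> nat set \<Rightarrow> (nat \<Rightarrow> 'f::zero) set" where
  "Delta m P = {v \<in> fvec m. supp v \<subseteq> P}"

definition DeltaC :: "nat \<Rightarrow> nat set \<Rightarrow> (nat \<Rightarrow> 'f::zero) set" where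
  "DeltaC m P = fvec m - Delta m P"

text \<open>Elements of F^{3m} are triples of vectors of F^m.\<close>
type_synonym 'f v3 = "(nat \<Rightarrow> 'f) \<times> (nat \<Rightarrow> 'f) \<times> (nat \<Rightarrow> 'f)"

definition N2 :: "nat \<Rightarrow> nat set \<Rightarrow> nat set \<Rightarrow> nat set \<Rightarrow> ('f::field) v3 set" where
  "N2 m A B C = {(w2 + \<omega>, w3, w1) | w1 w2 w3 \<omega>.
      w1 \<in> DeltaC m A \<and> w2 \<in> Delta m B \<and> w3 \<in> Delta m C \<and> \<omega> \<in> {0, w1}}"

definition scale3 :: "'f::field \<Rightarrow> 'f v3 \<Rightarrow> 'f v3" where
  "scale3 a x = (case x of (x1, x2, x3) \<Rightarrow> (\<lambda>i. a * x1 i, \<lambda>i. a * x2 i, \<lambda>i. a * x3 i))"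

definition proj_reps :: "('f::field) v3 set \<Rightarrow> 'f v3 set \<Rightarrow> bool" where
  "proj_reps N Nbar \<longleftrightarrow> Nbar \<subseteq> N \<and>
     (\<forall>x\<in>N. \<exists>!y. y \<in> Nbar \<and> (\<exists>a. a \<noteq> 0 \<and> y = scale3 a x))"

definition dot3 :: "nat \<Rightarrow> ('f::field) v3 \<Rightarrow> 'f v3 \<Rightarrow> 'f" where
  "dot3 m u x = (case u of (u1, u2, u3) \<Rightarrow> case x of (x1, x2, x3) \<Rightarrow>
      (\<Sum>i\<in>{1..m}. u1 i * x1 i + u2 i * x2 i + u3 i * x3 i))"

text \<open>The ambient space F_q^N, with coordinates indexed by the finite set I (|I| = N).\<close>
definition ambient :: "'i set \<Rightarrow> ('i \<Rightarrow> 'f::zero) set" where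
  "ambient I = {c. \<forall>x. x \<notin> I \<longrightarrow> c x = 0}"

text \<open>Row span of the 3m x |Nbar| matrix whose columns are the elements of Nbar.\<close>
definition code_of :: "nat \<Rightarrow> ('f::field) v3 set \<Rightarrow> ('f v3 \<Rightarrow> 'f) set" where
  "code_of m Nbar = {(\<lambda>x. if x \<in> Nbar then dot3 m u x else 0) | u.
      fst u \<in> fvec m \<and> fst (snd u) \<in> fvec m \<and> snd (snd u) \<in> fvec m}"

definition dual_code :: "'i set \<Rightarrow> ('i \<Rightarrow> 'f::field) set \<Rightarrow> ('i \<Rightarrow> 'f) set" where
  "dual_code I D = {c \<in> ambient I. \<forall>y\<in>D. (\<Sum>x\<in>I. c x * y x) = 0}"

definition hweight :: "'i set \<Rightarrow> ('i \<Rightarrow> 'f::zero) \<Rightarrow> nat" where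
  "hweight I c = card {x \<in> I. c x \<noteq> 0}"

definition coset :: "('i \<Rightarrow> 'f::ab_group_add) set \<Rightarrow> ('i \<Rightarrow> 'f) \<Rightarrow> ('i \<Rightarrow> 'f) set" where
  "coset D y = {y + d | d. d \<in> D}"

definition coset_weight :: "'i set \<Rightarrow> ('i \<Rightarrow> 'f::ab_group_add) set \<Rightarrow> ('i \<Rightarrow> 'f) \<Rightarrow> nat" where
  "coset_weight I D y = Min (hweight I ` coset D y)"

definition cg_vertices :: "'i set \<Rightarrow> ('i \<Rightarrow> 'f::ab_group_add) set \<Rightarrow> ('i \<Rightarrow> 'f) set set" where
  "cg_vertices I D = {coset D y | y. y \<in> ambient I}"

definition cg_adj :: "'i set \<Rightarrow> ('i \<Rightarrow> 'f::ab_group_add) set \<Rightarrow>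
    ('i \<Rightarrow> 'f) set \<Rightarrow> ('i \<Rightarrow> 'f) set \<Rightarrow> bool" where
  "cg_adj I D X Y \<longleftrightarrow> X \<in> cg_vertices I D \<and> Y \<in> cg_vertices I D \<and> X \<noteq> Y \<and>
     (\<exists>x y. X = coset D x \<and> Y = coset D y \<and> x \<in> ambient I \<and> y \<in> ambient I \<and>
        coset_weight I D (x - y) = 1)"

definition adj_matrix :: "('v \<Rightarrow> 'v \<Rightarrow> bool) \<Rightarrow> 'v \<Rightarrow> 'v \<Rightarrow> real" where
  "adj_matrix E v w = (if E v w then 1 else 0)"

definition is_eigenvalue :: "'v set \<Rightarrow> ('v \<Rightarrow> 'v \<Rightarrow> bool) \<Rightarrow> real \<Rightarrow> bool" where
  "is_eigenvalue V E ev \<longleftrightarrow> (\<exists>f :: 'v \<Rightarrow> real. (\<exists>v\<in>V. f v \<noteq> 0) \<and>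
      (\<forall>v\<in>V. (\<Sum>w\<in>V. adj_matrix E v w * f w) = ev * f v))"

definition set_det :: "'v set \<Rightarrow> ('v \<Rightarrow> 'v \<Rightarrow> 'a::comm_ring_1) \<Rightarrow> 'a" where
  "set_det V M = (\<Sum>p\<in>{p. p permutes V}. of_int (sign p) * (\<Prod>v\<in>V. M v (p v)))"

definition char_poly_graph :: "'v set \<Rightarrow> ('v \<Rightarrow> 'v \<Rightarrow> bool) \<Rightarrow> real poly" where
  "char_poly_graph V E = set_det V (\<lambda>v w. (if v = w then [:0, 1:] else 0) - [:adj_matrix E v w:])"

definition eig_mult :: "'v set \<Rightarrow> ('v \<Rightarrow> 'v \<Rightarrow> bool) \<Rightarrow> real \<Rightarrow> nat" where
  "eig_mult V E ev = order ev (char_poly_graph V E)"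

definition regular_graph :: "'v set \<Rightarrow> ('v \<Rightarrow> 'v \<Rightarrow> bool) \<Rightarrow> nat \<Rightarrow> bool" where
  "regular_graph V E k \<longleftrightarrow> (\<forall>v\<in>V. card {w \<in> V. E v w} = k)"

definition num_walks :: "'v set \<Rightarrow> ('v \<Rightarrow> 'v \<Rightarrow> bool) \<Rightarrow> nat \<Rightarrow> 'v \<Rightarrow> 'v \<Rightarrow> nat" where
  "num_walks V E l u v = card {ws. length ws = Suc l \<and> set ws \<subseteq> V \<and> hd ws = u \<and> last ws = v \<and>
      (\<forall>i<l. E (ws ! i) (ws ! Suc i))}"

definition strongly_walk_regular ::
  "'v set \<Rightarrow> ('v \<Rightarrow> 'v \<Rightarrow> bool) \<Rightarrow> nat \<Rightarrow> real \<Rightarrow> real \<Rightarrow> real \<Rightarrow> bool" where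
  "strongly_walk_regular V E l la mu nu \<longleftrightarrow>
     (\<forall>u\<in>V. \<forall>v\<in>V.
        (E u v \<longrightarrow> real (num_walks V E l u v) = la) \<and>
        (u \<noteq> v \<and> \<not> E u v \<longrightarrow> real (num_walks V E l u v) = mu) \<and>
        (u = v \<longrightarrow> real (num_walks V E l u v) = nu))"

end

theory Submission
  imports Defs "Jordan_Normal_Form.Char_Poly" "HOL-Library.Product_Plus"
begin

text \<open>
  Let \<open>t\<close> be the coordinate missing from \<open>A\<close>. The set \<open>N\<^sub>2\<close> consists of the \<open>(x\<^sub>1, x\<^sub>2, x\<^sub>3)\<close> in
  \<open>W = F\<^sup>m \<times> \<Delta>\<^sub>C \<times> F\<^sup>m\<close> with \<open>x\<^sub>3(t) \<noteq> 0\<close> and \<open>x\<^sub>1(t) \<in> {0, x\<^sub>3(t)}\<close>. It is closed under nonzero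
  scalars and spans \<open>W\<close>, so syndromes identify the coset graph with the Cayley graph of \<open>W\<close> for the
  connection set \<open>N\<^sub>2\<close>. In the coordinates \<open>p = x\<^sub>3(t) - x\<^sub>1(t)\<close> and \<open>q = x\<^sub>1(t)\<close>, two elements
  of \<open>W\<close> are adjacent iff exactly one of \<open>p\<close>, \<open>q\<close> agrees. Hence the graph is the blow-up of the
  \<open>4 \<times> 4\<close> rook graph in which every vertex is replaced by \<open>k = |W| / 16 = \<theta> / 2\<close> independent ones, and
  its adjacency matrix is \<open>(J\<^sub>4 \<otimes> I + I \<otimes> J\<^sub>4 - 2 I) \<otimes> J\<^sub>k\<close>. Triangularizing each \<open>J\<close> gives the
  spectrum, and the square of the rook matrix being \<open>4 I + 2 J\<close> gives the numbers of walks.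
\<close>

subsection \<open>Characteristic polynomials of matrices indexed by finite sets\<close>

text \<open>Conjugating permutations with \<open>f\<close> preserves their signs and only renames
  the factors of each product. This allows vertices to be renamed freely, in particular to be
  numbered.\<close>

lemma set_det_reindex:
  assumes "bij_betw f A B" "finite A"
  shows "set_det B M = set_det A (\<lambda>x y. M (f x) (f y))"
proof -
  have inj: "inj_on f A" and B: "B = f ` A"
    using assms(1) by (auto simp: bij_betw_def)
  have bij: "bij_betw (map_permutation A f) {p. p permutes A} {p. p permutes B}"
  proof (rule bij_betw_byWitness[where f' = "map_permutation B (inv_into A f)"])
    show "\<forall>p\<in>{p. p permutes A}. map_permutation B (inv_into A f) (map_permutation A f p) = p"
      using inj by (auto intro!: map_permutation_compose_inv[OF assms(1)])
    show "\<forall>p\<in>{p. p permutes B}. map_permutation A f (map_permutation B (inv_into A f) p) = p"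
      by (auto intro!: map_permutation_compose_inv[OF bij_betw_inv_into[OF assms(1)]]
          simp: B[symmetric] bij_betw_inv_into_right[OF assms(1)])
    show "map_permutation A f ` {p. p permutes A} \<subseteq> {p. p permutes B}"
      using map_permutation_permutes[OF assms(1)] by auto
    show "map_permutation B (inv_into A f) ` {p. p permutes B} \<subseteq> {p. p permutes A}"
      using map_permutation_permutes[OF bij_betw_inv_into[OF assms(1)]] by auto
  qed
  have "set_det B M = (\<Sum>p\<in>{p. p permutes A}. of_int (sign (map_permutation A f p)) *
      (\<Prod>v\<in>B. M v (map_permutation A f p v)))"
    unfolding set_det_def by (rule sum.reindex_bij_betw[OF bij, symmetric])
  also have "\<dots> = set_det A (\<lambda>x y. M (f x) (f y))"
    unfolding set_det_def B prod.reindex[OF inj]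
    by (intro sum.cong refl arg_cong2[where f = "(*)"])
       (auto simp: sign_map_permutation[OF inj _ assms(2)] map_permutation_apply[OF inj]
          intro!: prod.cong)
  finally show ?thesis .
qed

lemma set_det_eq_det: "set_det {0..<n} M = det (mat n n (\<lambda>(i, j). M i j))"
proof -
  have "(\<Prod>v = 0..<n. M v (p v)) = (\<Prod>i = 0..<n. mat n n (\<lambda>(i, j). M i j) $$ (i, p i))"
    if "p permutes {0..<n}" for p
    using permutes_in_image[OF that] by (intro prod.cong) auto
  then show ?thesis
    by (simp add: set_det_def det_def)
qed

definition set_char_poly :: "'v set \<Rightarrow> ('v \<Rightarrow> 'v \<Rightarrow> 'a::comm_ring_1) \<Rightarrow> 'a poly" where
  "set_char_poly V M = set_det V (\<lambda>v w. (if v = w then [:0, 1:] else 0) - [:M v w:])"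

lemma set_char_poly_eq_char_poly:
  assumes "bij_betw h {0..<n} V"
  shows "set_char_poly V M = char_poly (mat n n (\<lambda>(i, j). M (h i) (h j)))"
proof -
  have inj: "h i = h j \<longleftrightarrow> i = j" if "i < n" "j < n" for i j
    using assms that by (auto simp: bij_betw_def inj_on_def)
  show ?thesis
    unfolding set_char_poly_def set_det_reindex[OF assms finite_atLeastLessThan]
      set_det_eq_det char_poly_def char_poly_matrix_def
    by (rule arg_cong[of _ _ det]) (auto intro!: eq_matI simp: inj)
qed

text \<open>After numbering \<open>V\<close> by \<open>h\<close>, roots of the characteristic
  polynomial are eigenvalues of a matrix; \<open>h\<close> and its inverse translate between
  eigenvectors and functions on \<open>V\<close>.\<close>

lemma set_char_poly_root_iff:
  fixes M :: "'v \<Rightarrow> 'v \<Rightarrow> 'a::field"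
  assumes "finite V"
  shows "poly (set_char_poly V M) ev = 0 \<longleftrightarrow>
    (\<exists>f. (\<exists>v\<in>V. f v \<noteq> 0) \<and> (\<forall>v\<in>V. (\<Sum>w\<in>V. M v w * f w) = ev * f v))"
proof -
  obtain h where h: "bij_betw h {0..<card V} V"
    using ex_bij_betw_nat_finite[OF assms] by blast
  let ?n = "card V"
  let ?A = "mat ?n ?n (\<lambda>(i, j). M (h i) (h j))"
  let ?h' = "inv_into {0..<?n} h"
  have hV: "h i \<in> V" if "i < ?n" for i
    using h that by (auto simp: bij_betw_def)
  have h'h: "?h' (h i) = i" if "i < ?n" for i
    using bij_betw_inv_into_left[OF h] that by simp
  have hh': "h (?h' v) = v" "?h' v < ?n" if "v \<in> V" for v
    using bij_betw_inv_into_right[OF h that] bij_betw_apply[OF bij_betw_inv_into[OF h] that] by auto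
  have mult: "(?A *\<^sub>v x) $ i = (\<Sum>w\<in>V. M (h i) w * x $ ?h' w)"
    if "x \<in> carrier_vec ?n" "i < ?n" for x i
  proof -
    have "(?A *\<^sub>v x) $ i = (\<Sum>j\<in>{0..<?n}. M (h i) (h j) * x $ ?h' (h j))"
      using that by (auto simp: scalar_prod_def h'h intro!: sum.cong)
    then show ?thesis
      by (simp add: sum.reindex_bij_betw[OF h, of "\<lambda>w. M (h i) w * x $ ?h' w"])
  qed
  have "poly (set_char_poly V M) ev = 0 \<longleftrightarrow> eigenvalue ?A ev"
    unfolding set_char_poly_eq_char_poly[OF h]
    by (rule eigenvalue_root_char_poly[symmetric, where n = ?n]) simp
  also have "\<dots> \<longleftrightarrow> (\<exists>f. (\<exists>v\<in>V. f v \<noteq> 0) \<and> (\<forall>v\<in>V. (\<Sum>w\<in>V. M v w * f w) = ev * f v))"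
  proof
    assume "eigenvalue ?A ev"
    then obtain x where x: "x \<in> carrier_vec ?n" "x \<noteq> 0\<^sub>v ?n" "?A *\<^sub>v x = ev \<cdot>\<^sub>v x"
      by (auto simp: eigenvalue_def eigenvector_def)
    from x(1,2) obtain i where i: "i < ?n" "x $ i \<noteq> 0"
      by (metis carrier_vecD eq_vecI index_zero_vec)
    have "(\<Sum>w\<in>V. M v w * x $ ?h' w) = ev * x $ ?h' v" if "v \<in> V" for v
      using mult[OF x(1) hh'(2)[OF that]] x(1) hh'[OF that] by (simp add: x(3))
    moreover have "x $ ?h' (h i) \<noteq> 0"
      using i by (simp add: h'h)
    ultimately show "\<exists>f. (\<exists>v\<in>V. f v \<noteq> 0) \<and> (\<forall>v\<in>V. (\<Sum>w\<in>V. M v w * f w) = ev * f v)"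
      using hV[OF i(1)] by (intro exI[of _ "\<lambda>v. x $ ?h' v"]) auto
  next
    assume "\<exists>f. (\<exists>v\<in>V. f v \<noteq> 0) \<and> (\<forall>v\<in>V. (\<Sum>w\<in>V. M v w * f w) = ev * f v)"
    then obtain f v where f: "v \<in> V" "f v \<noteq> 0" "\<And>v. v \<in> V \<Longrightarrow> (\<Sum>w\<in>V. M v w * f w) = ev * f v"
      by blast
    let ?x = "vec ?n (\<lambda>i. f (h i))"
    have "?x $ ?h' v \<noteq> 0\<^sub>v ?n $ ?h' v"
      using f(1,2) hh'[OF f(1)] by simp
    then have "?x \<noteq> 0\<^sub>v ?n"
      by metis
    moreover have "?A *\<^sub>v ?x = ev \<cdot>\<^sub>v ?x"
    proof (rule eq_vecI)
      fix i assume "i < dim_vec (ev \<cdot>\<^sub>v ?x)"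
      then have i: "i < ?n" by simp
      have "(?A *\<^sub>v ?x) $ i = (\<Sum>w\<in>V. M (h i) w * ?x $ ?h' w)"
        by (rule mult) (use i in auto)
      also have "\<dots> = (\<Sum>w\<in>V. M (h i) w * f w)"
        by (intro sum.cong) (auto simp: hh')
      finally show "(?A *\<^sub>v ?x) $ i = (ev \<cdot>\<^sub>v ?x) $ i"
        using f(3)[OF hV[OF i]] i by simp
    qed simp
    ultimately show "eigenvalue ?A ev"
      by (auto simp: eigenvalue_def eigenvector_def intro!: exI[of _ ?x])
  qed
  finally show ?thesis .
qed

text \<open>\<open>P\<close> and \<open>Q\<close> are mutually inverse, so \<open>MP\<close> makes
  \<open>M\<close> similar to \<open>T\<close>. Listing \<open>V\<close> by increasing
  \<open>r\<close> makes \<open>T\<close> upper triangular, and its diagonal gives the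
  characteristic polynomial.\<close>

lemma set_char_poly_triangularizable:
  fixes M T P Q :: "'v \<Rightarrow> 'v \<Rightarrow> 'a::comm_ring_1" and r :: "'v \<Rightarrow> nat"
  assumes "finite V"
    and PQ: "\<And>v w. v \<in> V \<Longrightarrow> w \<in> V \<Longrightarrow> (\<Sum>u\<in>V. P v u * Q u w) = (if v = w then 1 else 0)"
    and QP: "\<And>v w. v \<in> V \<Longrightarrow> w \<in> V \<Longrightarrow> (\<Sum>u\<in>V. Q v u * P u w) = (if v = w then 1 else 0)"
    and MP: "\<And>v w. v \<in> V \<Longrightarrow> w \<in> V \<Longrightarrow> (\<Sum>u\<in>V. M v u * P u w) = (\<Sum>u\<in>V. P v u * T u w)"
    and T: "\<And>v w. v \<in> V \<Longrightarrow> w \<in> V \<Longrightarrow> v \<noteq> w \<Longrightarrow> T v w \<noteq> 0 \<Longrightarrow> r v < r w"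
  shows "set_char_poly V M = (\<Prod>v\<in>V. [:- T v v, 1:])"
proof -
  let ?n = "card V"
  obtain xs where xs: "distinct xs" "set xs = V"
    using finite_distinct_list[OF \<open>finite V\<close>] by blast
  \<comment> \<open>Ties in \<open>r\<close> may be broken arbitrarily, since \<open>T\<close>
    vanishes between distinct elements of equal rank.\<close>
  define ys where "ys = sort_key r xs"
  have ys: "distinct ys" "set ys = V" "length ys = ?n" "sorted (map r ys)"
    using xs distinct_card[of xs] by (auto simp: ys_def)
  let ?h = "\<lambda>i. ys ! i"
  have h: "bij_betw ?h {0..<?n} V"
    using ys by (auto intro!: bij_betw_nth)
  have inj: "?h i = ?h j \<longleftrightarrow> i = j" if "i < ?n" "j < ?n" for i j
    using nth_eq_iff_index_eq ys that by metis
  have hV: "?h i \<in> V" if "i < ?n" for i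
    using ys that nth_mem by metis
  define m where "m = (\<lambda>X :: 'v \<Rightarrow> 'v \<Rightarrow> 'a. mat ?n ?n (\<lambda>(i, j). X (?h i) (?h j)))"
  have carrier: "m X \<in> carrier_mat ?n ?n" for X
    by (simp add: m_def)
  have m_mult: "m X * m Y = m (\<lambda>v w. \<Sum>u\<in>V. X v u * Y u w)" for X Y
    unfolding m_def
    by (auto intro!: eq_matI simp: scalar_prod_def sum.reindex_bij_betw[OF h, symmetric])
  have m_eq: "m X = m Y" if "\<And>v w. v \<in> V \<Longrightarrow> w \<in> V \<Longrightarrow> X v w = Y v w" for X Y
    unfolding m_def using that hV by (auto intro!: eq_matI)
  have m_1: "m (\<lambda>v w. if v = w then 1 else 0) = 1\<^sub>m ?n"
    unfolding m_def by (auto intro!: eq_matI simp: inj)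
  have PQ': "m P * m Q = 1\<^sub>m ?n" and QP': "m Q * m P = 1\<^sub>m ?n"
    unfolding m_mult m_1[symmetric] by (rule m_eq; simp add: PQ QP)+
  have "m M = m M * (m P * m Q)"
    unfolding PQ' using carrier[of M] by simp
  also have "\<dots> = m M * m P * m Q"
    using carrier by (metis assoc_mult_mat)
  also have "m M * m P = m P * m T"
    unfolding m_mult by (rule m_eq) (rule MP)
  finally have "similar_mat (m M) (m T)"
    using carrier[of M] carrier[of T] carrier[of P] carrier[of Q] PQ' QP'
    by (intro similar_matI[where P = "m P" and Q = "m Q" and n = ?n]) simp_all
  then have "char_poly (m M) = char_poly (m T)"
    by (rule char_poly_similar)
  then have "set_char_poly V M = char_poly (m T)"
    by (simp add: set_char_poly_eq_char_poly[OF h] m_def)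
  also have "\<dots> = (\<Prod>a\<leftarrow>diag_mat (m T). [:- a, 1:])"
  proof (rule char_poly_upper_triangular[OF carrier])
    show "upper_triangular (m T)"
    proof (rule upper_triangularI)
      fix i j assume ij: "j < i" "i < dim_row (m T)"
      then have i: "i < ?n" by (simp add: m_def)
      have "r (?h j) \<le> r (?h i)"
        using sorted_nth_mono[OF ys(4), of j i] ij i ys(3) by simp
      then show "m T $$ (i, j) = 0"
        using T[of "?h i" "?h j"] hV inj[of i j] i ij by (force simp: m_def)
    qed
  qed
  also have "\<dots> = (\<Prod>i\<in>{0..<?n}. [:- T (?h i) (?h i), 1:])"
    by (simp add: diag_mat_def m_def prod.distinct_set_conv_list[symmetric] o_def
        cong: map_cong flip: atLeast_upt)
  also have "\<dots> = (\<Prod>v\<in>V. [:- T v v, 1:])"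
    by (rule prod.reindex_bij_betw[OF h])
  finally show ?thesis .
qed

lemma order_prod_linear:
  fixes d :: "'v \<Rightarrow> 'a::field"
  assumes "finite V"
  shows "order a (\<Prod>v\<in>V. [:- d v, 1:]) = card {v\<in>V. d v = a}"
  using assms
proof (induction V rule: finite_induct)
  case (insert x V)
  have "(\<Prod>v\<in>V. [:- d v, 1:]) \<noteq> 0"
    using insert.hyps by simp
  moreover have "order a [:- d x, 1:] = (if d x = a then 1 else 0)"
    by (simp add: order_linear')
  moreover have "{v \<in> insert x V. d v = a} = (if d x = a then insert x {v\<in>V. d v = a} else {v\<in>V. d v = a})"
    by auto
  ultimately show ?case
    using insert by (simp add: order_mult del: mult_pCons_left)
qed simp

subsection \<open>Graph isomorphisms and walks\<close>

lemma set_det_cong: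
  assumes "\<And>v w. v \<in> V \<Longrightarrow> w \<in> V \<Longrightarrow> M v w = M' v w"
  shows "set_det V M = set_det V M'"
  unfolding set_det_def
  by (intro sum.cong refl arg_cong2[where f = "(*)"] prod.cong)
     (auto intro!: assms simp: permutes_in_image)

lemma char_poly_graph_eq: "char_poly_graph V E = set_char_poly V (adj_matrix E)"
  by (simp add: char_poly_graph_def set_char_poly_def)

lemma is_eigenvalue_iff_root:
  "finite V \<Longrightarrow> is_eigenvalue V E ev \<longleftrightarrow> poly (char_poly_graph V E) ev = 0"
  by (simp add: char_poly_graph_eq set_char_poly_root_iff is_eigenvalue_def)

section \<open>Recursion for numbers of walks\<close>

lemma num_walks_0:
  assumes "u \<in> V"
  shows "num_walks V E 0 u v = (if u = v then 1 else 0)"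
proof -
  have "{ws. length ws = Suc 0 \<and> set ws \<subseteq> V \<and> hd ws = u \<and> last ws = v} = (if u = v then {[u]} else {})"
    using assms by (auto simp: length_Suc_conv)
  then show ?thesis
    by (simp add: num_walks_def)
qed

lemma num_walks_Suc:
  assumes "finite V" "u \<in> V"
  shows "real (num_walks V E (Suc l) u v) = (\<Sum>w\<in>V. adj_matrix E u w * real (num_walks V E l w v))"
proof -
  define S where "S = (\<lambda>l u. {ws. length ws = Suc l \<and> set ws \<subseteq> V \<and> hd ws = u \<and> last ws = v \<and>
      (\<forall>i<l. E (ws ! i) (ws ! Suc i))})"
  have fin: "finite (S l w)" for w
    by (rule finite_subset[OF _ finite_lists_length_eq[OF \<open>finite V\<close>, of "Suc l"]])
       (auto simp: S_def)
  \<comment> \<open>A walk from \<open>u\<close> is sorted by its second vertex \<open>w\<close>;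
    dropping \<open>u\<close> leaves a shorter walk from \<open>w\<close>. The sets for different
    \<open>w\<close> are disjoint because their tails have different heads.\<close>
  have "S (Suc l) u = (\<Union>w\<in>{w\<in>V. E u w}. (#) u ` S l w)"
  proof (intro equalityI subsetI)
    fix ws assume ws: "ws \<in> S (Suc l) u"
    then obtain ws' where ws': "ws = u # ws'" "length ws' = Suc l" "ws' \<noteq> []"
      by (auto simp: S_def length_Suc_conv)
    have "E (ws ! i) (ws ! Suc i)" if "i < Suc l" for i
      using ws that by (simp add: S_def)
    from this[of 0] this[of "Suc i" for i]
    have "E u (hd ws')" "\<And>i. i < l \<Longrightarrow> E (ws' ! i) (ws' ! Suc i)"
      using ws' by (auto simp: hd_conv_nth[of ws'])
    then show "ws \<in> (\<Union>w\<in>{w\<in>V. E u w}. (#) u ` S l w)"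
      using ws ws' by (auto simp: S_def intro!: exI[of _ "hd ws'"] split: if_splits)
  next
    fix ws assume "ws \<in> (\<Union>w\<in>{w\<in>V. E u w}. (#) u ` S l w)"
    then obtain w ws' where w: "w \<in> V" "E u w" "ws' \<in> S l w" "ws = u # ws'"
      by blast
    have "E (ws ! i) (ws ! Suc i)" if "i < Suc l" for i
      using w that by (cases i) (auto simp: S_def hd_conv_nth length_Suc_conv)
    then show "ws \<in> S (Suc l) u"
      using w assms(2) by (auto simp: S_def)
  qed
  then have "card (S (Suc l) u) = (\<Sum>w\<in>{w\<in>V. E u w}. card ((#) u ` S l w))"
    using assms(1) fin by (simp only:) (intro card_UN_disjoint, auto simp: S_def)
  also have "\<dots> = (\<Sum>w\<in>{w\<in>V. E u w}. card (S l w))"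
    by (intro sum.cong refl card_image) simp
  finally have "real (card (S (Suc l) u)) = (\<Sum>w\<in>V. if E u w then real (card (S l w)) else 0)"
    using assms(1) by (simp add: sum.inter_filter if_distrib[of real] cong: if_cong)
  then show ?thesis
    by (auto simp: num_walks_def S_def adj_matrix_def intro!: sum.cong)
qed

text \<open>Used twice: to identify the rook blow-up with a Cayley graph of syndromes, and then with
  the coset graph. Degrees, characteristic polynomials and walk counts are carried over.\<close>

locale graph_iso =
  fixes X :: "'u set" and R :: "'u \<Rightarrow> 'u \<Rightarrow> bool" and V :: "'v set" and E :: "'v \<Rightarrow> 'v \<Rightarrow> bool"
    and g :: "'u \<Rightarrow> 'v"
  assumes finite: "finite X" and bij: "bij_betw g X V"
    and adj: "\<And>x y. x \<in> X \<Longrightarrow> y \<in> X \<Longrightarrow> E (g x) (g y) \<longleftrightarrow> R x y"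
begin

lemma image: "V = g ` X"
  using bij by (simp add: bij_betw_def)

lemma inj: "x \<in> X \<Longrightarrow> y \<in> X \<Longrightarrow> g x = g y \<longleftrightarrow> x = y"
  using bij by (auto simp: bij_betw_def inj_on_def)

lemma regular_graph_iff: "regular_graph V E d \<longleftrightarrow> regular_graph X R d"
proof -
  have "card {w\<in>V. E (g x) w} = card {y\<in>X. R x y}" if "x \<in> X" for x
  proof -
    have "{w\<in>V. E (g x) w} = g ` {y\<in>X. R x y}"
      using that by (auto simp: image adj)
    then show ?thesis
      using inj by (simp add: card_image inj_on_def)
  qed
  then show ?thesis
    by (auto simp: regular_graph_def image)
qed

lemma char_poly_graph_eq: "char_poly_graph V E = char_poly_graph X R"
  unfolding char_poly_graph_def set_det_reindex[OF bij finite]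
  by (rule set_det_cong) (simp add: inj adj adj_matrix_def)

lemma num_walks_eq:
  "x \<in> X \<Longrightarrow> y \<in> X \<Longrightarrow> num_walks V E l (g x) (g y) = num_walks X R l x y"
proof (induction l arbitrary: x)
  case 0
  then show ?case
    by (simp add: num_walks_0 image inj)
next
  case (Suc l)
  have "real (num_walks V E (Suc l) (g x) (g y)) =
      (\<Sum>z\<in>X. adj_matrix E (g x) (g z) * real (num_walks V E l (g z) (g y)))"
    using Suc.prems finite by (simp add: num_walks_Suc image sum.reindex_bij_betw[OF bij, symmetric, unfolded image])
  also have "\<dots> = (\<Sum>z\<in>X. adj_matrix R x z * real (num_walks X R l z y))"
    using Suc by (intro sum.cong) (simp_all add: adj_matrix_def adj)
  finally show ?case
    using Suc.prems finite by (simp flip: num_walks_Suc)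
qed

lemma strongly_walk_regular_iff:
  "strongly_walk_regular V E l la mu nu \<longleftrightarrow> strongly_walk_regular X R l la mu nu"
  by (simp add: strongly_walk_regular_def image num_walks_eq[unfolded image] adj inj)

end

subsection \<open>Blow-ups of the rook graph on a four by four board\<close>

text \<open>A triple \<open>(a, b, c)\<close> is the copy number \<open>c\<close> of the cell
  \<open>(a, b)\<close> of the board. Adjacency ignores \<open>c\<close>, so the \<open>k\<close>
  copies of one cell are independent.\<close>

definition rook_vertices :: "nat \<Rightarrow> (nat \<times> nat \<times> nat) set" where
  "rook_vertices k = {..<4} \<times> {..<4} \<times> {..<k}"

definition rook_adj :: "nat \<times> nat \<times> nat \<Rightarrow> nat \<times> nat \<times> nat \<Rightarrow> bool" where
  "rook_adj = (\<lambda>(a, b, c) (a', b', c'). (a = a') \<noteq> (b = b'))"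

lemma finite_rook_vertices [simp]: "finite (rook_vertices k)"
  by (simp add: rook_vertices_def)

definition delta :: "nat \<Rightarrow> nat \<Rightarrow> real" where
  "delta x y = (if x = y then 1 else 0)"

lemma sum_delta:
  "x < n \<Longrightarrow> (\<Sum>y<n. delta x y * f y) = f x" "x < n \<Longrightarrow> (\<Sum>y<n. f y * delta y x) = f x"
  "x < n \<Longrightarrow> (\<Sum>y<n. delta x y) = 1" "x < n \<Longrightarrow> (\<Sum>y<n. delta y x) = 1"
  by (simp_all add: delta_def if_distrib[of "\<lambda>x. _ * x"] if_distrib[of "\<lambda>x. x * _"] cong: if_cong)

text \<open>The indicator of an exclusive or is \<open>x + y - 2 * x * y\<close>. As a polynomial in
  Kronecker deltas, it lets sums over all vertices factor along the three coordinates.\<close>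

lemma adj_matrix_rook:
  "adj_matrix rook_adj (a, b, c) (a', b', c') = delta a a' + delta b b' - 2 * delta a a' * delta b b'"
  by (simp add: adj_matrix_def rook_adj_def delta_def)

lemma sum_rook_vertices:
  "(\<Sum>v\<in>rook_vertices k. F v) = (\<Sum>a<4. \<Sum>b<4. \<Sum>c<k. F (a, b, c))"
  by (simp add: rook_vertices_def sum.cartesian_product)

lemma sum_rook_vertices_mult:
  fixes f g h :: "nat \<Rightarrow> real"
  shows "(\<Sum>a<4. \<Sum>b<4. \<Sum>c<k. f a * g b * h c) = (\<Sum>a<4. f a) * (\<Sum>b<4. g b) * (\<Sum>c<k. h c)"
  by (simp add: sum_distrib_left[symmetric] sum_distrib_right[symmetric])

lemma sum_rook_vertices_mult2:
  fixes f g :: "nat \<Rightarrow> real"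
  shows "(\<Sum>a<4. \<Sum>b<4. \<Sum>c<k. f a * g b) = real k * (\<Sum>a<4. f a) * (\<Sum>b<4. g b)"
  using sum_rook_vertices_mult[of f g "\<lambda>_. 1" k] by (simp add: mult_ac)

section \<open>Degrees and walks of odd length in the blow-up\<close>

lemma rook_adj_row_sum:
  assumes "v \<in> rook_vertices k"
  shows "(\<Sum>w\<in>rook_vertices k. adj_matrix rook_adj v w) = 6 * real k"
proof -
  obtain a b c where v: "v = (a, b, c)" "a < 4" "b < 4"
    using assms by (auto simp: rook_vertices_def)
  \<comment> \<open>The factors \<open>1\<close> give every summand the product form that
    \<open>sum_rook_vertices_mult2\<close> expects. The three terms contribute 4 + 4 - 2 = 6 cells,
    each with \<open>k\<close> copies.\<close>
  have "(\<Sum>w\<in>rook_vertices k. adj_matrix rook_adj v w) =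
      (\<Sum>a'<4. \<Sum>b'<4. \<Sum>c'<k. delta a a' * 1 + 1 * delta b b' - 2 * (delta a a' * delta b b'))"
    unfolding sum_rook_vertices v(1) adj_matrix_rook by (intro sum.cong refl) simp
  also have "\<dots> = 6 * real k"
    unfolding sum.distrib sum_subtractf sum_distrib_left[of 2, symmetric] sum_rook_vertices_mult2
    using v by (simp add: sum_delta)
  finally show ?thesis .
qed

text \<open>On the board a cell has 6 neighbours, and two distinct cells always have 2 common
  neighbours, whether or not they are in line. Each intermediate cell occurs in \<open>k\<close>
  copies.\<close>

lemma rook_adj_square:
  assumes "v \<in> rook_vertices k" "w \<in> rook_vertices k"
  shows "(\<Sum>u\<in>rook_vertices k. adj_matrix rook_adj v u * adj_matrix rook_adj u w) =
    real k * (4 * delta (fst v) (fst w) * delta (fst (snd v)) (fst (snd w)) + 2)"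
proof -
  obtain a b c a' b' c' where v: "v = (a, b, c)" "a < 4" "b < 4" and w: "w = (a', b', c')" "a' < 4" "b' < 4"
    using assms by (auto simp: rook_vertices_def)
  let ?d = "\<lambda>x. delta a x * delta x a'" and ?e = "\<lambda>y. delta b y * delta y b'"
  have "(\<Sum>u\<in>rook_vertices k. adj_matrix rook_adj v u * adj_matrix rook_adj u w) =
      (\<Sum>x<4. \<Sum>y<4. \<Sum>z<k. ?d x * 1 + delta a x * delta y b' - 2 * (?d x * delta y b')
        + (delta x a' * delta b y + 1 * ?e y - 2 * (delta x a' * ?e y))
        - 2 * (?d x * delta b y + delta a x * ?e y - 2 * (?d x * ?e y)))"
    unfolding sum_rook_vertices v(1) w(1) adj_matrix_rook
    by (intro sum.cong refl) (simp add: algebra_simps)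
  also have "\<dots> = real k * (4 * delta a a' * delta b b' + 2)"
    unfolding sum.distrib sum_subtractf sum_distrib_left[of 2, symmetric] sum_rook_vertices_mult2
    using v w by (simp add: sum_delta) (simp add: algebra_simps)
  finally show ?thesis
    by (simp add: v w)
qed

lemma rook_regular: "regular_graph (rook_vertices k) rook_adj (6 * k)"
  unfolding regular_graph_def
proof
  fix v assume v: "v \<in> rook_vertices k"
  have "real (card {w\<in>rook_vertices k. rook_adj v w}) = (\<Sum>w\<in>rook_vertices k. adj_matrix rook_adj v w)"
    by (simp add: adj_matrix_def flip: sum.inter_filter)
  then show "card {w\<in>rook_vertices k. rook_adj v w} = 6 * k"
    unfolding rook_adj_row_sum[OF v] by linarith
qed

text \<open>Let l be the length. On the eigenvalues 0 and +-2k, the power x^l equals (2k)^(l-1) x.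
  At 6k the excess is (6k)^l - (2k)^(l-1) 6k = (3^l - 3) (2k)^l, and it enters through the
  projection J / (16k) onto constant functions. The induction step multiplies by the square of the
  adjacency matrix.\<close>

lemma rook_num_walks_odd:
  assumes "v \<in> rook_vertices k" "w \<in> rook_vertices k"
  shows "real (num_walks (rook_vertices k) rook_adj (Suc (2 * n)) v w) =
    (2 * real k) ^ (2 * n) * adj_matrix rook_adj v w
      + (3 ^ Suc (2 * n) - 3) * (2 * real k) ^ Suc (2 * n) / (16 * real k)"
  using assms(1)
proof (induction n arbitrary: v)
  case 0
  \<comment> \<open>For length 1 the constant term vanishes because \<open>3 ^ 1 - 3 = 0\<close>,
    and the walks are the edges.\<close>
  have "(\<Sum>u\<in>rook_vertices k. adj_matrix rook_adj v u * (if u = w then 1 else 0)) = adj_matrix rook_adj v w"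
    using assms(2) by (simp add: if_distrib[of "\<lambda>x. _ * x"] cong: if_cong)
  then show ?case
    using 0 by (simp add: num_walks_Suc num_walks_0 if_distrib[of real] cong: sum.cong if_cong)
next
  case (Suc n)
  let ?X = "rook_vertices k" and ?A = "adj_matrix rook_adj"
  let ?N = "\<lambda>l v. real (num_walks ?X rook_adj l v w)"
  define s where "s = (2 * real k) ^ (2 * n)"
  define t where "t = (3 ^ Suc (2 * n) - 3) * (2 * real k) ^ Suc (2 * n) / (16 * real k)"
  obtain a b c a' b' c' where v: "v = (a, b, c)" "a < 4" "b < 4" "c < k"
      and w: "w = (a', b', c')" "a' < 4" "b' < 4"
    using assms Suc.prems by (auto simp: rook_vertices_def)
  have sym: "?A u w = ?A w u" for u
    by (cases u, cases w) (auto simp: adj_matrix_rook delta_def)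
  have IH: "?N (Suc (2 * n)) u = s * ?A u w + t" if "u \<in> ?X" for u
    using Suc.IH[OF that] by (simp add: s_def t_def)
  \<comment> \<open>Two steps are split off and grouped by their end vertex \<open>x\<close>, so
    that \<open>rook_adj_square\<close> applies. The product of the two deltas restricts
    \<open>x\<close> to the \<open>k\<close> copies of the cell of \<open>v\<close>.\<close>
  have "?N (Suc (2 * Suc n)) v = (\<Sum>u\<in>?X. ?A v u * ?N (Suc (Suc (2 * n))) u)"
    using num_walks_Suc[OF _ Suc.prems, of rook_adj "Suc (Suc (2 * n))" w] by simp
  also have "\<dots> = (\<Sum>u\<in>?X. \<Sum>x\<in>?X. ?A v u * ?A u x * ?N (Suc (2 * n)) x)"
    by (intro sum.cong refl)
       (simp add: num_walks_Suc[of ?X _ rook_adj "Suc (2 * n)"] sum_distrib_left mult.assoc)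
  also have "\<dots> = (\<Sum>x\<in>?X. (\<Sum>u\<in>?X. ?A v u * ?A u x) * ?N (Suc (2 * n)) x)"
    by (subst sum.swap) (simp add: sum_distrib_right)
  also have "\<dots> = (\<Sum>x\<in>?X. (real k * (4 * delta a (fst x) * delta b (fst (snd x)) + 2)) * (s * ?A x w + t))"
    using rook_adj_square[OF Suc.prems] by (intro sum.cong refl) (simp add: IH v)
  also have "\<dots> = 4 * real k * s * (\<Sum>x\<in>?X. delta a (fst x) * delta b (fst (snd x)) * ?A x w)
      + 4 * real k * t * (\<Sum>x\<in>?X. delta a (fst x) * delta b (fst (snd x)))
      + 2 * real k * s * (\<Sum>x\<in>?X. ?A w x) + 2 * real k * t * real (card ?X)"
    by (simp add: algebra_simps sum.distrib sum_distrib_left sym)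
  also have "(\<Sum>x\<in>?X. delta a (fst x) * delta b (fst (snd x))) = real k"
    unfolding sum_rook_vertices fst_conv snd_conv sum_rook_vertices_mult2 using v by (simp add: sum_delta)
  \<comment> \<open>Adjacency does not depend on the copy number, so summing over it multiplies by
    \<open>k\<close>, with copy \<open>0\<close> as representative.\<close>
  also have "(\<Sum>x\<in>?X. delta a (fst x) * delta b (fst (snd x)) * ?A x w) = 
      (\<Sum>x<4. delta a x * (\<Sum>y<4. delta b y * (real k * ?A (x, y, 0) w)))"
    by (simp add: sum_rook_vertices w adj_matrix_rook sum_distrib_left mult_ac)
  also have "\<dots> = real k * ?A v w"
    using v by (simp add: sum_delta w adj_matrix_rook)
  also have "(\<Sum>x\<in>?X. ?A w x) = 6 * real k"
    by (rule rook_adj_row_sum[OF assms(2)])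
  also have "card ?X = 16 * k"
    by (simp add: rook_vertices_def)
  finally have "?N (Suc (2 * Suc n)) v = 4 * (real k)\<^sup>2 * s * ?A v w + (36 * (real k)\<^sup>2 * t + 12 * (real k)\<^sup>2 * s)"
    by (simp add: algebra_simps power2_eq_square)
  moreover have "4 * (real k)\<^sup>2 * s = (2 * real k) ^ (2 * Suc n)"
    by (simp add: s_def power2_eq_square)
  \<comment> \<open>The recursion for the constant term: 36 = 4 + 2 * 16 collects the contributions
    of \<open>t\<close>, and 12 = 2 * 6 that of \<open>s\<close> by way of the row sum.\<close>
  moreover have "36 * (real k)\<^sup>2 * t + 12 * (real k)\<^sup>2 * s =
      (3 ^ Suc (2 * Suc n) - 3) * (2 * real k) ^ Suc (2 * Suc n) / (16 * real k)"
    using v by (simp add: s_def t_def power2_eq_square field_simps)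
  ultimately show ?case
    by simp
qed

lemma rook_strongly_walk_regular:
  assumes "odd l"
  shows "strongly_walk_regular (rook_vertices k) rook_adj l
    ((3 ^ l - 3) * (2 * real k) ^ l / (16 * real k) + (2 * real k) ^ (l - 1))
    ((3 ^ l - 3) * (2 * real k) ^ l / (16 * real k)) ((3 ^ l - 3) * (2 * real k) ^ l / (16 * real k))"
proof -
  obtain n where l: "l = Suc (2 * n)"
    using assms by (auto elim: oddE)
  have "\<not> rook_adj v v" for v
    by (cases v) (simp add: rook_adj_def)
  moreover have "real (num_walks (rook_vertices k) rook_adj l v w) =
      (2 * real k) ^ (l - 1) * adj_matrix rook_adj v w + (3 ^ l - 3) * (2 * real k) ^ l / (16 * real k)"
    if "v \<in> rook_vertices k" "w \<in> rook_vertices k" for v w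
    using rook_num_walks_odd[OF that, of n] by (simp add: l)
  ultimately show ?thesis
    unfolding strongly_walk_regular_def by (simp add: adj_matrix_def)
qed

section \<open>The spectrum of the blow-up\<close>

text \<open>The all-ones matrix of order \<open>n\<close> becomes triangular in the basis that is obtained from the
  standard one by replacing \<open>e\<^sub>0\<close> with the all-ones vector.\<close>

definition ones_basis :: "nat \<Rightarrow> nat \<Rightarrow> real" where
  "ones_basis x y = (if y = 0 \<or> x = y then 1 else 0)"

text \<open>Column 0 expresses \<open>e_0\<close> as the all-ones vector minus all the other
  standard basis vectors.\<close>

definition ones_basis_inv :: "nat \<Rightarrow> nat \<Rightarrow> real" where
  "ones_basis_inv x y = (if x = y then 1 else if y = 0 then - 1 else 0)"

text \<open>The all-ones matrix sends the all-ones vector to \<open>n\<close> times itself and each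
  standard basis vector to the all-ones vector; so only row 0 is nonzero.\<close>

definition ones_triangular :: "nat \<Rightarrow> nat \<Rightarrow> nat \<Rightarrow> real" where
  "ones_triangular n x y = (if x = 0 then if y = 0 then real n else 1 else 0)"

lemma ones_basis_mult_inv:
  assumes "x < n" "z < n"
  shows "(\<Sum>y<n. ones_basis x y * ones_basis_inv y z) = delta x z"
proof (cases "z = 0")
  case True
  have "(\<Sum>y<n. ones_basis x y * ones_basis_inv y z) =
      (\<Sum>y<n. (if y = 0 then 1 else 0) - (if x = 0 then 0 else if y = x then 1 else 0))"
    using True by (intro sum.cong) (auto simp: ones_basis_def ones_basis_inv_def)
  then show ?thesis
    using assms True by (simp add: sum_subtractf delta_def)
next
  case False
  have "(\<Sum>y<n. ones_basis x y * ones_basis_inv y z) = (\<Sum>y<n. ones_basis x y * delta y z)"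
    using False by (intro sum.cong) (auto simp: ones_basis_inv_def delta_def)
  then show ?thesis
    using assms False by (simp add: sum_delta) (simp add: ones_basis_def delta_def)
qed

lemma ones_basis_inv_mult:
  assumes "x < n" "z < n"
  shows "(\<Sum>y<n. ones_basis_inv x y * ones_basis y z) = delta x z"
proof -
  have "(\<Sum>y<n. ones_basis_inv x y * ones_basis y z) =
      (\<Sum>y<n. (if y = x then ones_basis x z else 0) - (if x = 0 then 0 else if y = 0 then ones_basis 0 z else 0))"
    using assms by (intro sum.cong) (auto simp: ones_basis_inv_def)
  then show ?thesis
    using assms by (cases "x = 0") (simp_all add: sum_subtractf delta_def ones_basis_def)
qed

text \<open>The right-hand side is an entry of the all-ones matrix times the basis matrix; such an
  entry is a column sum and so does not depend on the row \<open>x\<close>.\<close>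

lemma ones_basis_mult_triangular:
  assumes "x < n" "z < n"
  shows "(\<Sum>y<n. ones_basis x y * ones_triangular n y z) = (\<Sum>y<n. ones_basis y z)"
proof -
  have "(\<Sum>y<n. ones_basis x y * ones_triangular n y z) = (\<Sum>y<n. if y = 0 then ones_triangular n 0 z else 0)"
    by (intro sum.cong) (auto simp: ones_basis_def ones_triangular_def)
  also have "\<dots> = (\<Sum>y<n. ones_basis y z)"
    using assms by (cases "z = 0") (simp_all add: ones_basis_def ones_triangular_def)
  finally show ?thesis .
qed

text \<open>The adjacency matrix is a tensor expression in identity and all-ones matrices. The
  tensor cube of \<open>ones_basis\<close> replaces every all-ones factor by its triangular form at
  once.\<close>

lemma rook_char_poly:
  "char_poly_graph (rook_vertices k) rook_adj =
    (\<Prod>(a, b, c)\<in>rook_vertices k.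
      [:- ((ones_triangular 4 a a + ones_triangular 4 b b - 2) * ones_triangular k c c), 1:])"
proof -
  let ?p = ones_basis and ?q = ones_basis_inv and ?t = ones_triangular
  define P where "P = (\<lambda>(a, b, c) (a', b', c'). ?p a a' * ?p b b' * ?p c c')"
  define Q where "Q = (\<lambda>(a, b, c) (a', b', c'). ?q a a' * ?q b b' * ?q c c')"
  define T where "T = (\<lambda>(a, b, c) (a', b', c').
    (?t 4 a a' * delta b b' + delta a a' * ?t 4 b b' - 2 * (delta a a' * delta b b')) * ?t k c c')"
  \<comment> \<open>A nonzero entry of \<open>T\<close> at \<open>v\<close> and \<open>w\<close>
    forces each coordinate of \<open>v\<close> to be 0 or equal to that of \<open>w\<close>. If
    \<open>v\<close> and \<open>w\<close> differ, then \<open>w\<close> has more nonzero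
    coordinates, which is what \<open>rank\<close> counts.\<close>
  define rank :: "nat \<times> nat \<times> nat \<Rightarrow> nat"
    where "rank = (\<lambda>(a, b, c). of_bool (a \<noteq> 0) + of_bool (b \<noteq> 0) + of_bool (c \<noteq> 0))"
  have "char_poly_graph (rook_vertices k) rook_adj = (\<Prod>v\<in>rook_vertices k. [:- T v v, 1:])"
    unfolding char_poly_graph_eq
  proof (rule set_char_poly_triangularizable[where P = P and Q = Q and T = T and r = rank])
    show "finite (rook_vertices k)" by simp
  next
    fix v w assume "v \<in> rook_vertices k" "w \<in> rook_vertices k"
    then obtain a b c a' b' c' where v: "v = (a, b, c)" "a < 4" "b < 4" "c < k"
      and w: "w = (a', b', c')" "a' < 4" "b' < 4" "c' < k"
      by (auto simp: rook_vertices_def)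
    have "(\<Sum>u\<in>rook_vertices k. P v u * Q u w) =
        (\<Sum>x<4. \<Sum>y<4. \<Sum>z<k. (?p a x * ?q x a') * (?p b y * ?q y b') * (?p c z * ?q z c'))"
      unfolding sum_rook_vertices v(1) w(1) by (simp add: P_def Q_def mult_ac)
    also have "\<dots> = delta a a' * delta b b' * delta c c'"
      unfolding sum_rook_vertices_mult by (simp add: ones_basis_mult_inv v w)
    finally show "(\<Sum>u\<in>rook_vertices k. P v u * Q u w) = (if v = w then 1 else 0)"
      by (simp add: v w delta_def)
    have "(\<Sum>u\<in>rook_vertices k. Q v u * P u w) =
        (\<Sum>x<4. \<Sum>y<4. \<Sum>z<k. (?q a x * ?p x a') * (?q b y * ?p y b') * (?q c z * ?p z c'))"
      unfolding sum_rook_vertices v(1) w(1) by (simp add: P_def Q_def mult_ac)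
    also have "\<dots> = delta a a' * delta b b' * delta c c'"
      unfolding sum_rook_vertices_mult by (simp add: ones_basis_inv_mult v w)
    finally show "(\<Sum>u\<in>rook_vertices k. Q v u * P u w) = (if v = w then 1 else 0)"
      by (simp add: v w delta_def)
    let ?S = "\<lambda>n x. \<Sum>y<n. ?p y x"
    have "(\<Sum>u\<in>rook_vertices k. adj_matrix rook_adj v u * P u w) =
        (\<Sum>x<4. \<Sum>y<4. \<Sum>z<k. (delta a x * ?p x a') * ?p y b' * ?p z c'
          + ?p x a' * (delta b y * ?p y b') * ?p z c'
          - 2 * ((delta a x * ?p x a') * (delta b y * ?p y b') * ?p z c'))"
      unfolding sum_rook_vertices v(1) w(1) adj_matrix_rook
      by (intro sum.cong refl) (simp add: P_def algebra_simps)
    also have "\<dots> = (?p a a' * ?S 4 b' + ?S 4 a' * ?p b b' - 2 * (?p a a' * ?p b b')) * ?S k c'"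
      unfolding sum.distrib sum_subtractf sum_distrib_left[of 2, symmetric] sum_rook_vertices_mult
      using v by (simp add: sum_delta algebra_simps)
    \<comment> \<open>Each column sum becomes an entry of the basis matrix times a triangular one,
      and each bare entry of the basis matrix is multiplied by the identity.\<close>
    also have "\<dots> = (\<Sum>x<4. \<Sum>y<4. \<Sum>z<k.
          (?p a x * ?t 4 x a') * (?p b y * delta y b') * (?p c z * ?t k z c')
          + (?p a x * delta x a') * (?p b y * ?t 4 y b') * (?p c z * ?t k z c')
          - 2 * ((?p a x * delta x a') * (?p b y * delta y b') * (?p c z * ?t k z c')))"
      unfolding sum.distrib sum_subtractf sum_distrib_left[of 2, symmetric] sum_rook_vertices_mult
      using v w by (simp add: sum_delta ones_basis_mult_triangular) (simp add: algebra_simps)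
    also have "\<dots> = (\<Sum>u\<in>rook_vertices k. P v u * T u w)"
      unfolding sum_rook_vertices v(1) w(1)
      by (intro sum.cong refl) (simp add: P_def T_def algebra_simps)
    finally show "(\<Sum>u\<in>rook_vertices k. adj_matrix rook_adj v u * P u w) =
        (\<Sum>u\<in>rook_vertices k. P v u * T u w)" .
    show "rank v < rank w" if "v \<noteq> w" "T v w \<noteq> 0"
    proof -
      have t: "?t n x y \<noteq> 0 \<Longrightarrow> x = 0" for n x y
        by (simp add: ones_triangular_def split: if_splits)
      have "c = 0" "?t 4 a a' \<noteq> 0 \<and> b = b' \<or> a = a' \<and> ?t 4 b b' \<noteq> 0 \<or> a = a' \<and> b = b'"
        using that(2) t[of k c c'] by (auto simp: v(1) w(1) T_def delta_def split: if_splits)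
      then have "c = 0" "a = 0 \<and> b = b' \<or> a = a' \<and> b = 0 \<or> a = a' \<and> b = b'"
        using t by blast+
      then show ?thesis
        using that(1) by (auto simp: rank_def v(1) w(1))
    qed
  qed
  then show ?thesis
    by (simp add: T_def delta_def case_prod_beta)
qed

text \<open>Multiplicities are counted on the diagonal of the triangular form. An entry with
  \<open>c = 0\<close> is \<open>k\<close> times 4 + 4 - 2, 4 + 0 - 2 or 0 + 0 - 2, according to how
  many of \<open>a\<close> and \<open>b\<close> vanish: 1, 6 and 9 cases. The
  \<open>16 * (k - 1)\<close> entries with \<open>c > 0\<close> are 0.\<close>

lemma rook_eig_mult:
  assumes "k > 0"
  shows "eig_mult (rook_vertices k) rook_adj (6 * real k) = 1"
    and "eig_mult (rook_vertices k) rook_adj (2 * real k) = 6"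
    and "eig_mult (rook_vertices k) rook_adj 0 = 16 * k - 16"
    and "eig_mult (rook_vertices k) rook_adj (- 2 * real k) = 9"
    and "ev \<notin> {6 * real k, 2 * real k, 0, - 2 * real k} \<Longrightarrow> eig_mult (rook_vertices k) rook_adj ev = 0"
proof -
  define d where "d = (\<lambda>(a, b, c).
    (ones_triangular 4 a a + ones_triangular 4 b b - 2) * ones_triangular k c c)"
  have eq: "eig_mult (rook_vertices k) rook_adj ev = card {v\<in>rook_vertices k. d v = ev}" for ev
    unfolding eig_mult_def rook_char_poly
    using order_prod_linear[of "rook_vertices k" ev d] by (simp add: d_def case_prod_beta)
  have d: "d (a, b, c) = (if c = 0 then if a = 0 \<and> b = 0 then 6 * real k
      else if a = 0 \<or> b = 0 then 2 * real k else - 2 * real k else 0)" for a b c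
    by (simp add: d_def ones_triangular_def)
  have "{v\<in>rook_vertices k. d v = 6 * real k} = {(0, 0, 0)}"
    using assms by (auto simp: d rook_vertices_def split: if_splits)
  then show "eig_mult (rook_vertices k) rook_adj (6 * real k) = 1"
    by (simp add: eq)
  have "{v\<in>rook_vertices k. d v = 2 * real k} = {0} \<times> {1..<4} \<times> {0} \<union> {1..<4} \<times> {0} \<times> {0}"
    using assms by (auto simp: d rook_vertices_def split: if_splits)
  moreover have "card ({0} \<times> {1..<4} \<times> {0} \<union> {1..<4} \<times> {0} \<times> {0} :: (nat \<times> nat \<times> nat) set) = 6"
    by (subst card_Un_disjoint) auto
  ultimately show "eig_mult (rook_vertices k) rook_adj (2 * real k) = 6"
    by (simp add: eq)
  have "{v\<in>rook_vertices k. d v = 0} = {..<4} \<times> {..<4} \<times> {1..<k}"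
    using assms by (auto simp: d rook_vertices_def split: if_splits)
  then show "eig_mult (rook_vertices k) rook_adj 0 = 16 * k - 16"
    by (simp add: eq)
  have "{v\<in>rook_vertices k. d v = - 2 * real k} = {1..<4} \<times> {1..<4} \<times> {0}"
    using assms by (auto simp: d rook_vertices_def split: if_splits)
  then show "eig_mult (rook_vertices k) rook_adj (- 2 * real k) = 9"
    by (simp add: eq)
  show "eig_mult (rook_vertices k) rook_adj ev = 0"
    if "ev \<notin> {6 * real k, 2 * real k, 0, - 2 * real k}"
  proof -
    have "{v\<in>rook_vertices k. d v = ev} = {}"
      using that by (auto simp: d split: if_splits)
    then show ?thesis
      by (simp only: eq card.empty)
  qed
qed

text \<open>A number is an eigenvalue iff it has positive order as a root. With \<open>k > 1\<close>
  the multiplicity \<open>16 * k - 16\<close> of 0 is positive.\<close>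

lemma rook_is_eigenvalue_iff:
  assumes "k > 1"
  shows "is_eigenvalue (rook_vertices k) rook_adj ev \<longleftrightarrow> ev \<in> {6 * real k, 2 * real k, 0, - 2 * real k}"
proof -
  have "char_poly_graph (rook_vertices k) rook_adj \<noteq> 0"
    unfolding rook_char_poly by (auto simp: prod_zero_iff)
  then have "is_eigenvalue (rook_vertices k) rook_adj ev \<longleftrightarrow> eig_mult (rook_vertices k) rook_adj ev \<noteq> 0"
    by (simp add: is_eigenvalue_iff_root eig_mult_def order_root)
  then show ?thesis
    using assms rook_eig_mult[of k] by fastforce
qed

subsection \<open>Coset graphs as Cayley graphs of syndromes\<close>

lemma ambient_diff: "x \<in> ambient I \<Longrightarrow> y \<in> ambient I \<Longrightarrow> x - y \<in> ambient I"
  for x y :: "'i \<Rightarrow> 'f::ab_group_add"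
  by (simp add: ambient_def)

lemma ambient_add: "x \<in> ambient I \<Longrightarrow> y \<in> ambient I \<Longrightarrow> x + y \<in> ambient I"
  for x y :: "'i \<Rightarrow> 'f::ab_group_add"
  by (simp add: ambient_def)

lemma ambient_0: "0 \<in> ambient I"
  by (simp add: ambient_def)

text \<open>The code \<open>D\<close> is the kernel of a parity-check map \<open>syn\<close>, so its
  cosets are the fibres of \<open>syn\<close> and can be replaced by their syndromes.\<close>

locale syndrome_map =
  fixes I :: "'i set" and syn :: "('i \<Rightarrow> 'f::field) \<Rightarrow> 'a::ab_group_add" and D
  assumes finite_I: "finite I"
    and syn_add: "x \<in> ambient I \<Longrightarrow> y \<in> ambient I \<Longrightarrow> syn (x + y) = syn x + syn y"
    and D: "D = {c \<in> ambient I. syn c = 0}"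
begin

lemma syn_diff: "x \<in> ambient I \<Longrightarrow> y \<in> ambient I \<Longrightarrow> syn (x - y) = syn x - syn y"
  using syn_add[of "x - y" y] by (simp add: ambient_diff algebra_simps)

lemma syn_0: "syn 0 = 0"
  using syn_diff[of 0 0] by (simp add: ambient_0)

lemma coset_eq: "x \<in> ambient I \<Longrightarrow> coset D x = {z \<in> ambient I. syn z = syn x}"
proof (intro equalityI subsetI)
  fix z assume x: "x \<in> ambient I" and z: "z \<in> {z \<in> ambient I. syn z = syn x}"
  then have "z - x \<in> D"
    by (simp add: D ambient_diff syn_diff)
  then show "z \<in> coset D x"
    unfolding coset_def by (intro CollectI exI[of _ "z - x"]) simp
qed (auto simp: coset_def D ambient_add syn_add)

lemma coset_eq_iff:
  "x \<in> ambient I \<Longrightarrow> y \<in> ambient I \<Longrightarrow> coset D x = coset D y \<longleftrightarrow> syn x = syn y"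
  by (auto simp: coset_eq)

text \<open>The minimum is 1 iff the weight 1 is attained and the weight 0 is not. Only the zero
  vector has weight 0, so the latter means a nonzero syndrome.\<close>

lemma coset_weight_eq_1_iff:
  assumes "x \<in> ambient I"
  shows "coset_weight I D x = 1 \<longleftrightarrow> syn x \<noteq> 0 \<and> syn x \<in> syn ` {c \<in> ambient I. hweight I c = 1}"
proof -
  let ?W = "hweight I ` coset D x"
  have "hweight I c \<le> card I" for c
    unfolding hweight_def using finite_I by (intro card_mono) auto
  \<comment> \<open>\<open>Min\<close> is meaningful only on a finite nonempty set; weights are
    bounded by the length.\<close>
  then have fin: "finite ?W"
    by (intro finite_subset[of ?W "{..card I}"]) auto
  have ne: "?W \<noteq> {}"
    using assms by (auto simp: coset_eq)
  have zero: "c = 0" if "c \<in> ambient I" "hweight I c = 0" for c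
    using that finite_I by (auto simp: hweight_def ambient_def fun_eq_iff)
  have 0: "0 \<in> ?W \<longleftrightarrow> syn x = 0"
  proof -
    have "hweight I 0 = 0"
      by (simp add: hweight_def)
    moreover have "0 \<in> ?W \<longleftrightarrow> (\<exists>c\<in>ambient I. syn c = syn x \<and> hweight I c = 0)"
      unfolding coset_eq[OF assms] image_iff Bex_def mem_Collect_eq by metis
    ultimately show ?thesis
      using zero syn_0 ambient_0 by metis
  qed
  have 1: "1 \<in> ?W \<longleftrightarrow> syn x \<in> syn ` {c \<in> ambient I. hweight I c = 1}"
    unfolding coset_eq[OF assms] image_iff Bex_def mem_Collect_eq by metis
  have "(\<forall>a\<in>S. 1 \<le> a) \<longleftrightarrow> 0 \<notin> S" for S :: "nat set"
    by (auto simp: Suc_le_eq intro: gr0I)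
  then have "Min ?W = 1 \<longleftrightarrow> 0 \<notin> ?W \<and> 1 \<in> ?W"
    unfolding Min_eq_iff[OF fin ne] by blast
  then show ?thesis
    by (simp only: coset_weight_def 0 1)
qed

text \<open>Adjacency quantifies over representatives, but the weight of the difference depends only
  on the syndromes, which the cosets determine.\<close>

lemma cg_adj_iff:
  assumes "x \<in> ambient I" "y \<in> ambient I"
  shows "cg_adj I D (coset D x) (coset D y) \<longleftrightarrow>
    syn x \<noteq> syn y \<and> syn x - syn y \<in> syn ` {c \<in> ambient I. hweight I c = 1}"
proof -
  let ?S = "syn ` {c \<in> ambient I. hweight I c = 1}"
  have weight: "coset_weight I D (x' - y') = 1 \<longleftrightarrow> syn x' \<noteq> syn y' \<and> syn x' - syn y' \<in> ?S"
    if "x' \<in> ambient I" "y' \<in> ambient I" for x' y'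
    using coset_weight_eq_1_iff[OF ambient_diff[OF that]] that by (simp add: syn_diff)
  show ?thesis
  proof
    assume "cg_adj I D (coset D x) (coset D y)"
    then obtain x' y' where "coset D x = coset D x'" "coset D y = coset D y'"
        "x' \<in> ambient I" "y' \<in> ambient I" "coset_weight I D (x' - y') = 1"
      unfolding cg_adj_def by blast
    then show "syn x \<noteq> syn y \<and> syn x - syn y \<in> ?S"
      using weight[of x' y'] assms coset_eq_iff[of x x'] coset_eq_iff[of y y'] by simp
  next
    assume "syn x \<noteq> syn y \<and> syn x - syn y \<in> ?S"
    then have "coset D x \<noteq> coset D y" "coset_weight I D (x - y) = 1"
      using weight[OF assms] coset_eq_iff[OF assms] by simp_all
    then show "cg_adj I D (coset D x) (coset D y)"
      unfolding cg_adj_def cg_vertices_def using assms by blast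
  qed
qed

lemma bij_betw_cosets:
  "bij_betw (\<lambda>w. coset D (inv_into (ambient I) syn w)) (syn ` ambient I) (cg_vertices I D)"
proof -
  let ?r = "inv_into (ambient I) syn"
  have r: "?r w \<in> ambient I" "syn (?r w) = w" if "w \<in> syn ` ambient I" for w
    using that by (simp_all add: inv_into_into f_inv_into_f)
  have "inj_on (\<lambda>w. coset D (?r w)) (syn ` ambient I)"
  proof (rule inj_onI)
    fix w w' assume "w \<in> syn ` ambient I" "w' \<in> syn ` ambient I" "coset D (?r w) = coset D (?r w')"
    then show "w = w'"
      using r coset_eq_iff by metis
  qed
  moreover have "(\<lambda>w. coset D (?r w)) ` syn ` ambient I = cg_vertices I D"
  proof -
    have "coset D x = coset D (?r (syn x))" if "x \<in> ambient I" for x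
      using that r[of "syn x"] coset_eq_iff by simp
    then show ?thesis
      unfolding cg_vertices_def using r(1) by blast
  qed
  ultimately show ?thesis
    by (simp add: bij_betw_def)
qed

text \<open>The assumption concerns the Cayley graph on syndromes whose connection set consists of
  the syndromes of weight-one vectors. It is composed with the bijection from syndromes to
  cosets.\<close>

lemma graph_iso_cosets:
  assumes "graph_iso X R (syn ` ambient I)
    (\<lambda>u w. u \<noteq> w \<and> u - w \<in> syn ` {c \<in> ambient I. hweight I c = 1}) g"
  shows "graph_iso X R (cg_vertices I D) (cg_adj I D) (\<lambda>x. coset D (inv_into (ambient I) syn (g x)))"
proof -
  interpret graph_iso X R "syn ` ambient I"
    "\<lambda>u w. u \<noteq> w \<and> u - w \<in> syn ` {c \<in> ambient I. hweight I c = 1}" g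
    by (rule assms)
  show ?thesis
  proof
    show "bij_betw (\<lambda>x. coset D (inv_into (ambient I) syn (g x))) X (cg_vertices I D)"
      using bij_betw_trans[OF bij bij_betw_cosets] by (simp add: o_def)
    fix x y assume "x \<in> X" "y \<in> X"
    moreover from this have "g x \<in> syn ` ambient I" "g y \<in> syn ` ambient I"
      using bij_betw_apply[OF bij] by blast+
    ultimately show "cg_adj I D (coset D (inv_into (ambient I) syn (g x)))
        (coset D (inv_into (ambient I) syn (g y))) \<longleftrightarrow> R x y"
      using adj[of x y] by (simp add: cg_adj_iff inv_into_into f_inv_into_f)
  qed (rule finite)
qed

end

subsection \<open>The dual of a code spanned by the rows of a matrix\<close>

text \<open>The linear combination of the columns with coefficients \<open>c\<close>, that is, the
  generator matrix of the code applied to \<open>c\<close>; for the dual code it is the parity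
  check.\<close>

definition syndrome :: "('f::field) v3 set \<Rightarrow> ('f v3 \<Rightarrow> 'f) \<Rightarrow> 'f v3" where
  "syndrome I c = (\<lambda>i. \<Sum>x\<in>I. c x * fst x i, \<lambda>i. \<Sum>x\<in>I. c x * fst (snd x) i,
    \<lambda>i. \<Sum>x\<in>I. c x * snd (snd x) i)"

lemma syndrome_add: "syndrome I (c + d) = syndrome I c + syndrome I d"
  by (simp add: syndrome_def fun_eq_iff sum.distrib distrib_right)

definition single :: "'i \<Rightarrow> 'f::zero \<Rightarrow> 'i \<Rightarrow> 'f" where
  "single i a = (\<lambda>j. if j = i then a else 0)"

lemma syndrome_single:
  assumes "finite I" "x \<in> I"
  shows "syndrome I (single x a) = scale3 a x"
proof -
  have "(\<Sum>y\<in>I. single x a y * f y) = a * f x" for f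
    using assms by (simp add: single_def if_distrib[of "\<lambda>z. z * _"] cong: if_cong)
  then show ?thesis
    by (simp add: syndrome_def scale3_def case_prod_beta)
qed

lemma hweight_eq_1_iff:
  assumes "c \<in> ambient I"
  shows "hweight I c = 1 \<longleftrightarrow> (\<exists>x\<in>I. \<exists>a. a \<noteq> 0 \<and> c = single x a)"
proof
  assume "hweight I c = 1"
  then obtain x where x: "{y\<in>I. c y \<noteq> 0} = {x}"
    by (auto simp: hweight_def card_1_singleton_iff)
  then have "c = single x (c x)"
    using assms by (auto simp: single_def ambient_def fun_eq_iff)
  then show "\<exists>x\<in>I. \<exists>a. a \<noteq> 0 \<and> c = single x a"
    using x by blast
next
  assume "\<exists>x\<in>I. \<exists>a. a \<noteq> 0 \<and> c = single x a"
  then obtain x a where "x \<in> I" "a \<noteq> 0" "c = single x a" by blast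
  then have "{y\<in>I. c y \<noteq> 0} = {x}"
    by (auto simp: single_def)
  then show "hweight I c = 1"
    by (simp add: hweight_def)
qed

text \<open>A vector of weight one selects a single column and scales it by a nonzero
  factor.\<close>

lemma syndrome_weight_1:
  fixes I :: "('f::field) v3 set"
  assumes "finite I"
  shows "syndrome I ` {c \<in> ambient I. hweight I c = 1} = (\<lambda>(a, x). scale3 a x) ` ({a. a \<noteq> 0} \<times> I)"
proof -
  have single: "single x a \<in> ambient I" if "x \<in> I" for x and a :: 'f
    using that by (auto simp: single_def ambient_def)
  have "{c \<in> ambient I. hweight I c = 1} = (\<lambda>(a, x). single x a) ` ({a :: 'f. a \<noteq> 0} \<times> I)"
  proof (rule Set.set_eqI)
    fix c :: "'f v3 \<Rightarrow> 'f"
    have "c \<in> ambient I \<and> hweight I c = 1 \<longleftrightarrow> (\<exists>x\<in>I. \<exists>a. a \<noteq> 0 \<and> c = single x a)"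
      using single hweight_eq_1_iff by metis
    then show "c \<in> {c \<in> ambient I. hweight I c = 1} \<longleftrightarrow>
        c \<in> (\<lambda>(a, x). single x a) ` ({a. a \<noteq> 0} \<times> I)"
      by (simp add: image_iff) blast
  qed
  then have "syndrome I ` {c \<in> ambient I. hweight I c = 1} =
      (\<lambda>z. syndrome I (case z of (a, x) \<Rightarrow> single x a)) ` ({a. a \<noteq> 0} \<times> I)"
    by (simp add: image_image)
  also have "\<dots> = (\<lambda>(a, x). scale3 a x) ` ({a. a \<noteq> 0} \<times> I)"
    by (rule image_cong) (use syndrome_single[OF assms] in auto)
  finally show ?thesis .
qed

lemma dot3_syndrome:
  "(\<Sum>x\<in>I. c x * dot3 m u x) = dot3 m u (syndrome I c)"
proof -
  obtain u1 u2 u3 where u: "u = (u1, u2, u3)" by (cases u) auto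
  have "(\<Sum>x\<in>I. c x * dot3 m u x) = (\<Sum>x\<in>I. \<Sum>i\<in>{1..m}.
      u1 i * (c x * fst x i) + u2 i * (c x * fst (snd x) i) + u3 i * (c x * snd (snd x) i))"
    by (simp add: dot3_def u case_prod_beta sum_distrib_left algebra_simps)
  also have "\<dots> = dot3 m u (syndrome I c)"
    by (subst sum.swap) (simp add: dot3_def u syndrome_def sum.distrib sum_distrib_left)
  finally show ?thesis .
qed

text \<open>Testing against the unit vectors reads off every coordinate of \<open>z\<close> in
  \<open>{1..m}\<close>; the others vanish by membership in \<open>fvec m\<close>.\<close>

lemma dot3_nondegenerate:
  assumes "z \<in> fvec m \<times> fvec m \<times> fvec m"
    and "\<And>u. u \<in> fvec m \<times> fvec m \<times> fvec m \<Longrightarrow> dot3 m u z = 0"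
  shows "z = 0"
proof -
  obtain z1 z2 z3 where z: "z = (z1, z2, z3)" by (cases z) auto
  have fvec: "single i 1 \<in> fvec m" if "i \<in> {1..m}" for i
    using that by (simp add: single_def fvec_def)
  have 0: "0 \<in> fvec m" by (simp add: fvec_def)
  have dot: "(\<Sum>j\<in>{1..m}. single i 1 j * f j) = f i" if "i \<in> {1..m}" for i and f :: "nat \<Rightarrow> 'a"
    using that by (simp add: single_def if_distrib[of "\<lambda>z. z * _"] cong: if_cong)
  have "z1 i = 0 \<and> z2 i = 0 \<and> z3 i = 0" for i
  proof (cases "i \<in> {1..m}")
    case True
    have "dot3 m (single i 1, 0, 0) z = 0" "dot3 m (0, single i 1, 0) z = 0"
      "dot3 m (0, 0, single i 1) z = 0"
      by (rule assms(2); simp add: fvec[OF True] 0)+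
    then show ?thesis
      using dot[OF True] by (simp add: dot3_def z)
  next
    case False
    then show ?thesis
      using assms(1) by (auto simp: z fvec_def)
  qed
  then show ?thesis
    by (simp add: z zero_prod_def fun_eq_iff)
qed

section \<open>Coordinate subspaces and the kernel description of the dual code\<close>

lemma fvec_iff: "v \<in> fvec m \<longleftrightarrow> (\<forall>i. i \<notin> {1..m} \<longrightarrow> v i = 0)"
  by (auto simp: fvec_def simp del: atLeastAtMost_iff)

lemma Delta_iff: "v \<in> Delta m P \<longleftrightarrow> (\<forall>i. i \<notin> {1..m} \<inter> P \<longrightarrow> v i = 0)"
  by (auto simp: Delta_def fvec_def supp_def simp del: atLeastAtMost_iff)

lemma fvec_eq_Delta: "fvec m = Delta m {1..m}"
  by (simp add: set_eq_iff fvec_iff Delta_iff)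

lemma Delta_closed:
  fixes v w :: "nat \<Rightarrow> 'f::ring"
  shows "0 \<in> Delta m P"
    and "v \<in> Delta m P \<Longrightarrow> w \<in> Delta m P \<Longrightarrow> v + w \<in> Delta m P"
    and "v \<in> Delta m P \<Longrightarrow> w \<in> Delta m P \<Longrightarrow> v - w \<in> Delta m P"
    and "v \<in> Delta m P \<Longrightarrow> (\<lambda>i. a * v i) \<in> Delta m P"
  by (simp_all add: Delta_iff)

lemma fvec_closed:
  fixes v w :: "nat \<Rightarrow> 'f::ring"
  shows "0 \<in> fvec m"
    and "v \<in> fvec m \<Longrightarrow> w \<in> fvec m \<Longrightarrow> v + w \<in> fvec m"
    and "v \<in> fvec m \<Longrightarrow> w \<in> fvec m \<Longrightarrow> v - w \<in> fvec m"
    and "v \<in> fvec m \<Longrightarrow> (\<lambda>i. a * v i) \<in> fvec m"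
  by (simp_all add: fvec_iff)

lemma single_in_fvec: "i \<in> {1..m} \<Longrightarrow> single i a \<in> fvec m"
  by (simp add: fvec_iff single_def)

lemma syndrome_in_fvec:
  assumes "I \<subseteq> fvec m \<times> Delta m C \<times> fvec m"
  shows "syndrome I c \<in> fvec m \<times> Delta m C \<times> fvec m"
proof -
  have I: "fst x \<in> fvec m" "fst (snd x) \<in> Delta m C" "snd (snd x) \<in> fvec m" if "x \<in> I" for x
    using subsetD[OF assms that] by (auto simp: mem_Times_iff)
  show ?thesis
    unfolding syndrome_def mem_Times_iff fst_conv snd_conv fvec_iff Delta_iff
    using I unfolding fvec_iff Delta_iff by (auto intro!: sum.neutral simp del: atLeastAtMost_iff)
qed

text \<open>Pairing \<open>c\<close> with the codeword of \<open>u\<close> gives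
  \<open>dot3 m u (syndrome I c)\<close>. By nondegeneracy this vanishes for all \<open>u\<close>
  only if the syndrome does.\<close>

lemma dual_code_of:
  assumes "I \<subseteq> fvec m \<times> fvec m \<times> fvec m"
  shows "dual_code I (code_of m I) = {c \<in> ambient I. syndrome I c = 0}"
proof -
  have "(\<forall>y\<in>code_of m I. (\<Sum>x\<in>I. c x * y x) = 0) \<longleftrightarrow> syndrome I c = 0" for c
  proof -
    have "(\<forall>y\<in>code_of m I. (\<Sum>x\<in>I. c x * y x) = 0) \<longleftrightarrow>
        (\<forall>u\<in>fvec m \<times> fvec m \<times> fvec m. (\<Sum>x\<in>I. c x * dot3 m u x) = 0)"
    proof -
      have "code_of m I = (\<lambda>u x. if x \<in> I then dot3 m u x else 0) ` (fvec m \<times> fvec m \<times> fvec m)"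
        unfolding code_of_def by (simp add: image_def mem_Times_iff) blast
      moreover have "(\<Sum>x\<in>I. c x * (if x \<in> I then dot3 m u x else 0)) = (\<Sum>x\<in>I. c x * dot3 m u x)" for u
        by (intro sum.cong) auto
      ultimately show ?thesis
        by (simp only: ball_simps)
    qed
    also have "\<dots> \<longleftrightarrow> syndrome I c = 0"
    proof
      assume "\<forall>u\<in>fvec m \<times> fvec m \<times> fvec m. (\<Sum>x\<in>I. c x * dot3 m u x) = 0"
      \<comment> \<open>Taking \<open>{1..m}\<close> for \<open>C\<close> turns
        \<open>Delta m C\<close> into \<open>fvec m\<close>, which places the syndrome where
        nondegeneracy applies.\<close>
      then show "syndrome I c = 0"
        using assms syndrome_in_fvec[of I m "{1..m}" c, folded fvec_eq_Delta]
        unfolding dot3_syndrome by (intro dot3_nondegenerate) auto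
    next
      assume "syndrome I c = 0"
      then show "\<forall>u\<in>fvec m \<times> fvec m \<times> fvec m. (\<Sum>x\<in>I. c x * dot3 m u x) = 0"
        unfolding dot3_syndrome by (simp add: dot3_def zero_prod_def case_prod_beta)
    qed
    finally show ?thesis .
  qed
  then show ?thesis
    by (simp add: dual_code_def)
qed

lemma card_Delta:
  assumes "P \<subseteq> {1..m}"
  shows "card (Delta m P :: (nat \<Rightarrow> 'f::{zero,finite}) set) = card (UNIV :: 'f set) ^ card P"
    and "finite (Delta m P :: (nat \<Rightarrow> 'f) set)"
proof -
  have P: "v \<in> Delta m P \<longleftrightarrow> (\<forall>i. i \<notin> P \<longrightarrow> v i = 0)" for v :: "nat \<Rightarrow> 'f"
    using assms unfolding Delta_iff by blast
  \<comment> \<open>Both sides are functions on \<open>P\<close>, extended by 0 in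
    \<open>Delta m P\<close> and by \<open>undefined\<close> in the extensional function
    space.\<close>
  have bij: "bij_betw (\<lambda>v. restrict v P) (Delta m P) (P \<rightarrow>\<^sub>E (UNIV :: 'f set))"
    by (rule bij_betw_byWitness[where f' = "\<lambda>v i. if i \<in> P then v i else 0"])
       (auto simp: P fun_eq_iff PiE_def extensional_def)
  have "finite P"
    using assms finite_subset by blast
  then show "card (Delta m P :: (nat \<Rightarrow> 'f) set) = card (UNIV :: 'f set) ^ card P"
    using bij_betw_same_card[OF bij] by (simp add: card_PiE)
  show "finite (Delta m P :: (nat \<Rightarrow> 'f) set)"
    using bij_betw_finite[OF bij] \<open>finite P\<close> by (simp add: finite_PiE)
qed

subsection \<open>The coset graph as a blow-up of the rook graph\<close>

text \<open>Membership in \<open>Delta m A\<close> means vanishing at \<open>t\<close>. Hence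
  \<open>w2\<close> contributes nothing to the first component at \<open>t\<close>, and the value
  there reveals which \<open>\<omega>\<close> was added.\<close>

lemma N2_complement_singleton:
  assumes t: "t \<in> {1..m}" "A = {1..m} - {t}"
  shows "(N2 m A A C :: ('f::field) v3 set) = {x \<in> fvec m \<times> Delta m C \<times> fvec m.
    snd (snd x) t \<noteq> 0 \<and> fst x t \<in> {0, snd (snd x) t}}" (is "_ = ?N")
proof -
  have A: "v \<in> Delta m A \<longleftrightarrow> v \<in> fvec m \<and> v t = 0" for v :: "nat \<Rightarrow> 'f"
    unfolding Delta_iff fvec_iff using t by blast
  have Ac: "v \<in> DeltaC m A \<longleftrightarrow> v \<in> fvec m \<and> v t \<noteq> 0" for v :: "nat \<Rightarrow> 'f"
    by (auto simp: DeltaC_def A)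
  show ?thesis
  proof (intro equalityI subsetI)
    fix x :: "'f v3" assume "x \<in> N2 m A A C"
    then obtain w1 w2 w3 \<omega> where x: "x = (w2 + \<omega>, w3, w1)" "w1 \<in> DeltaC m A" "w2 \<in> Delta m A"
        "w3 \<in> Delta m C" "\<omega> = 0 \<or> \<omega> = w1"
      unfolding N2_def by blast
    then have "w2 + \<omega> \<in> fvec m"
      unfolding A Ac by (auto intro: fvec_closed)
    then show "x \<in> ?N"
      using x unfolding A Ac by auto
  next
    fix x :: "'f v3" assume x: "x \<in> ?N"
    \<comment> \<open>Chosen so that the first component minus \<open>\<omega>\<close> vanishes at
      \<open>t\<close>.\<close>
    define \<omega> where "\<omega> = (if fst x t = 0 then 0 else snd (snd x))"
    have "fst x - \<omega> \<in> Delta m A"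
      using x by (auto simp: A \<omega>_def intro: fvec_closed)
    moreover have "\<omega> \<in> {0, snd (snd x)}" "snd (snd x) \<in> DeltaC m A" "fst (snd x) \<in> Delta m C"
      using x by (auto simp: Ac \<omega>_def)
    moreover have "x = ((fst x - \<omega>) + \<omega>, fst (snd x), snd (snd x))"
      by (simp add: prod_eq_iff)
    ultimately show "x \<in> N2 m A A C"
      unfolding N2_def by blast
  qed
qed

lemma scale3_scale3: "scale3 a (scale3 b x) = scale3 (a * b) x"
  by (simp add: scale3_def case_prod_beta mult.assoc)

lemma scale3_1: "scale3 1 x = x"
  by (simp add: scale3_def case_prod_beta)

lemma proj_reps_scale3:
  assumes reps: "proj_reps N Nbar" and closed: "\<And>a x. a \<noteq> 0 \<Longrightarrow> x \<in> N \<Longrightarrow> scale3 a x \<in> N"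
  shows "(\<lambda>(a, x). scale3 a x) ` ({a. a \<noteq> 0} \<times> Nbar) = N"
proof (intro equalityI subsetI)
  fix x assume "x \<in> N"
  then obtain y a where y: "y \<in> Nbar" "a \<noteq> 0" "y = scale3 a x"
    using reps unfolding proj_reps_def by blast
  then have "x = scale3 (inverse a) y" "inverse a \<noteq> 0"
    by (simp_all add: scale3_scale3 scale3_1)
  then show "x \<in> (\<lambda>(a, x). scale3 a x) ` ({a. a \<noteq> 0} \<times> Nbar)"
    using y(1) by force
qed (use reps closed in \<open>auto simp: proj_reps_def\<close>)

text \<open>Used to show that every element of \<open>W\<close> is a syndrome. Membership in
  \<open>N\<close> means that exactly one of the coordinates p and q is zero, and every pair splits
  into two such pairs.\<close>

lemma connection_set_sum_of_two:
  fixes t :: nat and W N :: "('f::field) v3 set"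
  assumes t: "t \<in> {1..m}" and q: "\<exists>a::'f. a \<notin> {0, 1}"
    and W: "W = fvec m \<times> Delta m C \<times> fvec m"
    and N: "N = {x \<in> W. snd (snd x) t \<noteq> 0 \<and> fst x t \<in> {0, snd (snd x) t}}"
    and w: "w \<in> W"
  shows "\<exists>x\<in>N. w - x \<in> N"
proof -
  let ?p = "snd (snd w) t - fst w t" and ?q = "fst w t"
  obtain a :: 'f where a: "a \<noteq> 0" "a \<noteq> 1" using q by blast
  \<comment> \<open>\<open>s p q\<close> is supported at position \<open>t\<close> and has the
    prescribed coordinates p and q.\<close>
  define s where "s = (\<lambda>p q. (single t q, 0, single t (p + q)) :: 'f v3)"
  have sW: "s p q \<in> W" "w - s p q \<in> W" for p q
    using w by (auto simp: W s_def mem_Times_iff single_in_fvec[OF t] fvec_closed Delta_closed)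
  have s: "s p q \<in> N \<longleftrightarrow> (p = 0) \<noteq> (q = 0)" for p q
    using sW[of p q] by (auto simp: N s_def single_def)
  have ws: "w - s p q \<in> N \<longleftrightarrow> (?p = p) \<noteq> (?q = q)" for p q
  proof -
    have "w - s p q \<in> N \<longleftrightarrow> snd (snd w) t - (p + q) \<noteq> 0 \<and> ?q - q \<in> {0, snd (snd w) t - (p + q)}"
      using sW(2)[of p q] by (simp add: N s_def single_def)
    then show ?thesis
      by (auto simp: algebra_simps)
  qed
  \<comment> \<open>Zero is \<open>x + (- x)\<close>; two nonzero coordinates are separated; a
    single nonzero coordinate y is split as \<open>a * y + (1 - a) * y\<close>, where
    \<open>a \<noteq> 0\<close> and \<open>a \<noteq> 1\<close> keep both parts nonzero.\<close>
  consider "?p = 0" "?q = 0" | "?p = 0" "?q \<noteq> 0" | "?p \<noteq> 0" "?q = 0" | "?p \<noteq> 0" "?q \<noteq> 0"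
    by blast
  then show ?thesis
  proof cases
    case 1
    then show ?thesis using s[of 1 0] ws[of 1 0] by auto
  next
    case 2
    then show ?thesis using s[of 0 "a * ?q"] ws[of 0 "a * ?q"] a by auto
  next
    case 3
    then show ?thesis using s[of "a * ?p" 0] ws[of "a * ?p" 0] a by auto
  next
    case 4
    then show ?thesis using s[of ?p 0] ws[of ?p 0] by auto
  qed
qed

text \<open>\<open>W\<close> is the direct sum of the plane of all \<open>s (a, b)\<close> and the
  common kernel \<open>W0\<close> of \<open>p\<close> and \<open>q\<close>. Numbering the field
  gives the board, and numbering \<open>W0\<close> gives the \<open>k\<close> copies.\<close>

lemma graph_iso_rook:
  fixes t :: nat and W N :: "('f::{field,finite}) v3 set"
  assumes q4: "card (UNIV :: 'f set) = 4"
    and t: "t \<in> {1..m}" and C: "C \<subseteq> {1..m}"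
    and W: "W = fvec m \<times> Delta m C \<times> fvec m"
    and N: "N = {x \<in> W. snd (snd x) t \<noteq> 0 \<and> fst x t \<in> {0, snd (snd x) t}}"
  shows "\<exists>k g. 16 * k = 4 ^ (2 * m + card C) \<and>
    graph_iso (rook_vertices k) rook_adj W (\<lambda>u w. u \<noteq> w \<and> u - w \<in> N) g"
proof -
  have finW: "finite W"
    unfolding W fvec_eq_Delta using card_Delta(2) C by blast
  have "card W = 4 ^ m * (4 ^ card C * 4 ^ m)"
    unfolding W fvec_eq_Delta card_cartesian_product using card_Delta(1)[of _ m, where 'f = 'f] C q4 by simp
  then have cardW: "card W = 4 ^ (2 * m + card C)"
    by (simp add: power_add mult_2)
  define p q :: "'f v3 \<Rightarrow> 'f" where "p = (\<lambda>w. snd (snd w) t - fst w t)" and "q = (\<lambda>w. fst w t)"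
  have pq_diff: "p (u - w) = p u - p w" "q (u - w) = q u - q w" for u w
    by (simp_all add: p_def q_def)
  have pq_add: "p (u + w) = p u + p w" "q (u + w) = q u + q w" for u w
    by (simp_all add: p_def q_def)
  define W0 where "W0 = {w\<in>W. p w = 0 \<and> q w = 0}"
  define s where "s = (\<lambda>(a, b). (single t b, 0, single t (a + b)) :: 'f v3)"
  have pq_s: "p (s (a, b)) = a" "q (s (a, b)) = b" for a b
    by (simp_all add: s_def p_def q_def single_def)
  have W_add: "u + w \<in> W" and W_diff: "u - w \<in> W" if "u \<in> W" "w \<in> W" for u w
    using that by (simp_all add: W mem_Times_iff fvec_closed Delta_closed)
  have sW: "s z \<in> W" for z
    by (simp add: W s_def single_in_fvec[OF t] Delta_closed split: prod.split)
  let ?G = "\<lambda>(z, w). s z + w"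
  have G: "bij_betw ?G (UNIV \<times> W0) W"
    by (rule bij_betw_byWitness[where f' = "\<lambda>w. ((p w, q w), w - s (p w, q w))"])
       (auto simp: W0_def pq_add pq_diff pq_s W_add W_diff sW)
  define k where "k = card W0"
  obtain e :: "nat \<Rightarrow> 'f" where e: "bij_betw e {..<4} (UNIV :: 'f set)"
    using ex_bij_betw_nat_finite[of "UNIV :: 'f set"] q4 by (auto simp: atLeast0LessThan)
  obtain h where h: "bij_betw h {..<k} W0"
    using ex_bij_betw_nat_finite[of W0] finW by (auto simp: W0_def k_def atLeast0LessThan)
  have e_inj: "e a = e a' \<longleftrightarrow> a = a'" if "a < 4" "a' < 4" for a a'
    using e that by (auto simp: bij_betw_def inj_on_def)
  have hW0: "h c \<in> W0" if "c < k" for c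
    using h that by (auto simp: bij_betw_def)
  have h_inj: "h c = h c' \<longleftrightarrow> c = c'" if "c < k" "c' < k" for c c'
    using h that by (auto simp: bij_betw_def inj_on_def)
  let ?g = "\<lambda>(a, b, c). ?G ((e a, e b), h c)"
  have "bij_betw (\<lambda>(a, b, c). ((e a, e b), h c)) (rook_vertices k) (UNIV \<times> W0)"
    (is "bij_betw ?f _ _")
  proof (rule bij_betw_imageI)
    show "inj_on ?f (rook_vertices k)"
      by (rule inj_onI) (auto simp: rook_vertices_def e_inj h_inj)
    have "((a, b), c) \<in> ?f ` rook_vertices k" if "c \<in> W0" for a b c
    proof -
      have "a \<in> e ` {..<4}" "b \<in> e ` {..<4}" "c \<in> h ` {..<k}"
        using that bij_betw_imp_surj_on[OF e] bij_betw_imp_surj_on[OF h] by simp_all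
      then obtain a' b' c' where "a' < 4" "b' < 4" "c' < k" "a = e a'" "b = e b'" "c = h c'"
        by auto
      then show ?thesis
        by (intro image_eqI[of _ _ "(a', b', c')"]) (auto simp: rook_vertices_def)
    qed
    then show "?f ` rook_vertices k = UNIV \<times> W0"
      using hW0 by (auto simp: rook_vertices_def)
  qed
  from bij_betw_trans[OF this G] have g: "bij_betw ?g (rook_vertices k) W"
    by (simp add: o_def case_prod_unfold)
  have "16 * k = card W"
    using bij_betw_same_card[OF g] by (simp add: rook_vertices_def)
  moreover have "graph_iso (rook_vertices k) rook_adj W (\<lambda>u w. u \<noteq> w \<and> u - w \<in> N) ?g"
  proof
    fix x y assume xy: "x \<in> rook_vertices k" "y \<in> rook_vertices k"
    then obtain a b c a' b' c' where x: "x = (a, b, c)" "a < 4" "b < 4" "c < k"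
      and y: "y = (a', b', c')" "a' < 4" "b' < 4" "c' < k"
      by (auto simp: rook_vertices_def)
    have pq: "p (?g x) = e a" "q (?g x) = e b" "p (?g y) = e a'" "q (?g y) = e b'"
      using hW0[OF x(4)] hW0[OF y(4)] by (simp_all add: x y pq_add pq_s W0_def)
    \<comment> \<open>If \<open>q d = 0\<close>, the third component at \<open>t\<close> equals
      \<open>p d\<close> and must be nonzero. Otherwise the first and third components agree at
      \<open>t\<close>, so \<open>p d = 0\<close>.\<close>
    have N_iff: "d \<in> N \<longleftrightarrow> (p d = 0) \<noteq> (q d = 0)" if "d \<in> W" for d
      using that unfolding N p_def q_def by (cases "fst d t = 0") auto
    have "?g x - ?g y \<in> W"
      by (rule W_diff[OF bij_betw_apply[OF g xy(1)] bij_betw_apply[OF g xy(2)]])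
    then have "?g x - ?g y \<in> N \<longleftrightarrow> (e a = e a') \<noteq> (e b = e b')"
      by (simp only: N_iff pq_diff pq right_minus_eq)
    also have "\<dots> \<longleftrightarrow> rook_adj x y"
      using x y by (simp add: rook_adj_def e_inj)
    finally have adj: "?g x - ?g y \<in> N \<longleftrightarrow> rook_adj x y" .
    moreover have "0 \<notin> N"
      by (simp add: N)
    ultimately show "(?g x \<noteq> ?g y \<and> ?g x - ?g y \<in> N) \<longleftrightarrow> rook_adj x y"
      by (metis right_minus_eq)
  qed (use g in simp_all)
  ultimately show ?thesis
    unfolding cardW by blast
qed

text \<open>Weight-one syndromes are exactly \<open>N\<close>, since scaling the representatives
  recovers all of \<open>N2\<close>, and the syndromes fill \<open>W\<close>. The coset graph is
  thus the Cayley graph of \<open>W\<close> with connection set \<open>N\<close>.\<close>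

lemma coset_graph_iso_rook:
  fixes m :: nat and A C :: "nat set" and Nbar :: "('f::{field,finite}) v3 set"
  assumes q4: "card (UNIV :: 'f set) = 4"
    and A: "A \<subseteq> {1..m}" "card A = m - 1" "m > 0"
    and C: "C \<subseteq> {1..m}"
    and reps: "proj_reps (N2 m A A C) Nbar"
  defines "D \<equiv> dual_code Nbar (code_of m Nbar)"
  shows "\<exists>k g. 16 * k = 4 ^ (2 * m + card C) \<and>
    graph_iso (rook_vertices k) rook_adj (cg_vertices Nbar D) (cg_adj Nbar D) g"
proof -
  have "card ({1..m} - A) = 1"
    using A by (simp add: card_Diff_subset finite_subset[OF A(1)])
  then obtain t where "{1..m} - A = {t}"
    by (auto simp: card_1_singleton_iff)
  then have t: "t \<in> {1..m}" "A = {1..m} - {t}"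
    using A by auto
  define W :: "'f v3 set" where "W = fvec m \<times> Delta m C \<times> fvec m"
  define N where "N = {x \<in> W. snd (snd x) t \<noteq> 0 \<and> fst x t \<in> {0, snd (snd x) t}}"
  have N2: "N2 m A A C = N"
    unfolding N_def W_def by (rule N2_complement_singleton[OF t])
  have finW: "finite W"
    unfolding W_def fvec_eq_Delta using card_Delta(2) C by blast
  have sub: "Nbar \<subseteq> W"
    using reps unfolding proj_reps_def N2 N_def by blast
  have fin: "finite Nbar"
    using finW sub finite_subset by blast
  have sub3: "Nbar \<subseteq> fvec m \<times> fvec m \<times> fvec m"
    using sub by (auto simp: W_def Delta_def)
  interpret syndrome_map Nbar "syndrome Nbar" D
    by standard (use fin in \<open>simp_all add: syndrome_add D_def dual_code_of[OF sub3]\<close>)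
  have "scale3 a x \<in> N" if "a \<noteq> 0" "x \<in> N" for a x
    using that by (auto simp: N_def W_def scale3_def fvec_closed Delta_closed split: prod.splits)
  then have weight_1: "syndrome Nbar ` {c \<in> ambient Nbar. hweight Nbar c = 1} = N"
    unfolding syndrome_weight_1[OF fin] using proj_reps_scale3 reps N2 by blast
  have surj: "syndrome Nbar ` ambient Nbar = W"
  proof (intro equalityI subsetI)
    fix w assume "w \<in> syndrome Nbar ` ambient Nbar"
    then show "w \<in> W"
      using syndrome_in_fvec[of Nbar m C] sub by (auto simp: W_def)
  next
    fix w assume "w \<in> W"
    have "\<exists>a::'f. a \<notin> {0, 1}"
    proof (rule ccontr)
      assume "\<not> ?thesis"
      then have "(UNIV :: 'f set) = {0, 1}" by auto
      then have "card (UNIV :: 'f set) = card {0 :: 'f, 1}" by (rule arg_cong)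
      then show False using q4 by simp
    qed
    from connection_set_sum_of_two[OF t(1) this W_def N_def \<open>w \<in> W\<close>]
    obtain x where "x \<in> N" "w - x \<in> N" by blast
    \<comment> \<open>Both summands are syndromes of weight-one vectors, so the sum of these vectors
      is a preimage of \<open>w\<close>.\<close>
    then obtain c d where "c \<in> ambient Nbar" "d \<in> ambient Nbar"
        "syndrome Nbar c = x" "syndrome Nbar d = w - x"
      unfolding weight_1[symmetric] by auto
    then show "w \<in> syndrome Nbar ` ambient Nbar"
      by (intro image_eqI[of _ _ "c + d"]) (simp_all add: syndrome_add ambient_add)
  qed
  obtain k g where "16 * k = 4 ^ (2 * m + card C)"
      "graph_iso (rook_vertices k) rook_adj W (\<lambda>u w. u \<noteq> w \<and> u - w \<in> N) g"
    using graph_iso_rook[OF q4 t(1) C W_def N_def] by blast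
  then show ?thesis
    using graph_iso_cosets[unfolded weight_1 surj] by blast
qed

theorem mainTheorem20:
  fixes m :: nat and A B C :: "nat set" and Nbar :: "('f::{field,finite}) v3 set"
  assumes q4: "card (UNIV :: 'f set) = 4"
    and m2: "m \<ge> 2"
    and A: "A \<noteq> {}" "A \<subseteq> {1..m}"
    and B: "B \<noteq> {}" "B \<subseteq> {1..m}"
    and C: "C \<noteq> {}" "C \<subseteq> {1..m}"
    and BA: "B = A"
    and cardA: "card A = m - 1"
    and reps: "proj_reps (N2 m A B C) Nbar"
  defines "\<theta> \<equiv> (2::nat) ^ (4 * m + 2 * card C - 3)"
    and "V \<equiv> cg_vertices Nbar (dual_code Nbar (code_of m Nbar))"
    and "E \<equiv> cg_adj Nbar (dual_code Nbar (code_of m Nbar))"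
  shows "regular_graph V E (3 * \<theta>)
       \<and> {ev. is_eigenvalue V E ev} = {real (3 * \<theta>), real \<theta>, 0, - real \<theta>}
       \<and> eig_mult V E (real (3 * \<theta>)) = 1
       \<and> eig_mult V E (real \<theta>) = 6
       \<and> eig_mult V E 0 = 4 ^ (2 * m + card C) - 16
       \<and> eig_mult V E (- real \<theta>) = 9
       \<and> (\<forall>l::nat. odd l \<and> l \<ge> 3 \<longrightarrow>
            strongly_walk_regular V E l
              ((3 ^ l - 3) * real \<theta> ^ l / 4 ^ (2 * m + card C) + real \<theta> ^ (l - 1))
              ((3 ^ l - 3) * real \<theta> ^ l / 4 ^ (2 * m + card C))
              ((3 ^ l - 3) * real \<theta> ^ l / 4 ^ (2 * m + card C)))"
proof -
  obtain k g where k: "16 * k = 4 ^ (2 * m + card C)"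
    and iso: "graph_iso (rook_vertices k) rook_adj V E g"
    using coset_graph_iso_rook[OF q4 A(2) cardA _ C(2)] reps m2 unfolding V_def E_def BA by fastforce
  interpret graph_iso "rook_vertices k" rook_adj V E g
    by (rule iso)
  \<comment> \<open>The bound on \<open>m\<close> keeps the natural subtraction in the exponent from
    truncating. Then \<open>8 * \<theta> = 16 * k\<close>, so
    \<open>\<theta> = 2 * k\<close>.\<close>
  have "(2::nat) ^ 3 * \<theta> = 2 ^ (4 * m + 2 * card C)"
    unfolding \<theta>_def using m2 by (subst power_add[symmetric]) simp
  also have "\<dots> = 4 ^ (2 * m + card C)"
    using power_mult[of "2::nat" 2 "2 * m + card C"] by (simp add: algebra_simps)
  finally have \<theta>: "\<theta> = 2 * k"
    using k by simp
  \<comment> \<open>This gives \<open>k \<ge> 4\<close>, so 0 really occurs among the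
    eigenvalues.\<close>
  have "(4::nat) ^ 3 \<le> 4 ^ (2 * m + card C)"
    using m2 by (intro power_increasing) auto
  then have "k > 1"
    using k by simp
  have card: "4 ^ (2 * m + card C) = 16 * real k"
    using arg_cong[OF k, of real] by simp
  have eig: "eig_mult V E ev = eig_mult (rook_vertices k) rook_adj ev" for ev
    by (simp add: eig_mult_def char_poly_graph_eq)
  have "is_eigenvalue V E ev \<longleftrightarrow> ev \<in> {6 * real k, 2 * real k, 0, - 2 * real k}" for ev
    using rook_is_eigenvalue_iff[OF \<open>k > 1\<close>]
    by (simp add: is_eigenvalue_iff_root image char_poly_graph_eq[unfolded image])
  moreover have "regular_graph V E (3 * \<theta>)"
    using rook_regular[of k] by (simp add: regular_graph_iff \<theta>)
  ultimately show ?thesis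
    using rook_eig_mult(1-4)[of k] \<open>k > 1\<close> rook_strongly_walk_regular[of _ k]
    unfolding eig strongly_walk_regular_iff card k[symmetric] \<theta> by auto
qed

end
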